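(* Let $c\in(0,1)$ be a constant. For each $n$, let the bit positions $[n]$ be partitioned into $N$ disjoint nonempty subsets $\sigma_1,\dots,\sigma_N$, each of size at most $r$, and for each $\ell\in[N]$ let $f_\ell:\{0,1\}^n\to\{0,1\}$ be a Boolean function depending only on the bits in $\sigma_\ell$ and taking the value $1$ for some assignment of these bits. Let $\mathrm{DECOMP}(x):=\sum_{\ell=1}^N a_\ell f_\ell(x)$ with integer weights $a_1\ge a_2\ge\dots\ge a_N>0$. Consider Algorithm 1 on $\mathrm{DECOMP}$ with fitness-proportionate selection, bitwise mutation with rate $\chi/n$ where $\chi=(1-c)/(na_1)$, and population size $\lambda$ satisfying $\lambda\ge c'n^2a_1^2r\ln(na_1)$ and $\lambda=O((na_1)^K)$, where $c'$ and $K$ are sufficiently large positive constants. Then the expected runtime is $$E[T]=O\!\left(n^2a_1\lambda\log(na_1)+n^{2r+2}a_1^{r+1}(1-c)^{-r}\right).$$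
   Context: Algorithm 1 (non-elitist EA): the search space is $\mathcal X=\{0,1\}^n$; the initial population $P_0\in\mathcal X^\lambda$ is sampled uniformly at random. In each generation $t$, the new population $P_{t+1}$ is formed by $\lambda$ independent repetitions of: sample an index $I=\mathrm{sel}(P_t)\in[\lambda]$ by the selection mechanism and set the offspring to $\mathrm{mutate}(P_t(I))$. Fitness-proportionate selection selects index $i$ with probability $f(P(i))/\sum_{j=1}^\lambda f(P(j))$ (convention: uniform if all fitnesses are $0$). Bitwise mutation with rate $\chi/n$ flips each bit independently with probability $\chi/n$. The runtime is $T:=\min\{t\lambda : P_t \text{ contains an optimum of } f\}$. Asymptotic notation is with respect to $n\to\infty$. *)

theory Defs
  imports "HOL-Probability.Probability"
begin

text \<open>Bit strings of length n are modelled as bool lists of length n; bit positions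
  are 0-based, i.e. [n] is represented by {0..<n}. A population of size lam is a
  list of lam bit strings.\<close>

fun mutate :: "real \<Rightarrow> bool list \<Rightarrow> bool list pmf" where
  "mutate p [] = return_pmf []"
| "mutate p (x # xs) =
     bind_pmf (bernoulli_pmf p) (\<lambda>b. map_pmf (\<lambda>ys. (x \<noteq> b) # ys) (mutate p xs))"

fun iid_list :: "nat \<Rightarrow> 'a pmf \<Rightarrow> 'a list pmf" where
  "iid_list 0 D = return_pmf []"
| "iid_list (Suc k) D = bind_pmf D (\<lambda>x. map_pmf (\<lambda>xs. x # xs) (iid_list k D))"

definition uniform_bitstrings :: "nat \<Rightarrow> bool list pmf" where
  "uniform_bitstrings n = pmf_of_set {xs. length xs = n}"

definition fp_select :: "(bool list \<Rightarrow> real) \<Rightarrow> bool list list \<Rightarrow> nat pmf" where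
  "fp_select f P =
     (let S = (\<Sum>i<length P. f (P ! i)) in
      if S = 0 then pmf_of_set {..<length P}
      else embed_pmf (\<lambda>i. if i < length P then f (P ! i) / S else 0))"

definition ea_step :: "(bool list \<Rightarrow> real) \<Rightarrow> real \<Rightarrow> bool list list \<Rightarrow> bool list list pmf" where
  "ea_step f p P = iid_list (length P) (bind_pmf (fp_select f P) (\<lambda>i. mutate p (P ! i)))"

definition is_optimum :: "nat \<Rightarrow> (bool list \<Rightarrow> real) \<Rightarrow> bool list \<Rightarrow> bool" where
  "is_optimum n f x \<longleftrightarrow> length x = n \<and> (\<forall>y. length y = n \<longrightarrow> f y \<le> f x)"

definition has_optimum :: "nat \<Rightarrow> (bool list \<Rightarrow> real) \<Rightarrow> bool list list \<Rightarrow> bool" where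
  "has_optimum n f P \<longleftrightarrow> (\<exists>x\<in>set P. is_optimum n f x)"

fun ea_state :: "nat \<Rightarrow> (bool list \<Rightarrow> real) \<Rightarrow> nat \<Rightarrow> real \<Rightarrow> nat \<Rightarrow> (bool list list \<times> bool) pmf" where
  "ea_state n f lam p 0 =
     map_pmf (\<lambda>P. (P, has_optimum n f P)) (iid_list lam (uniform_bitstrings n))"
| "ea_state n f lam p (Suc t) =
     bind_pmf (ea_state n f lam p t)
       (\<lambda>(P, b). map_pmf (\<lambda>Q. (Q, b \<or> has_optimum n f Q)) (ea_step f p P))"

text \<open>E[T] for T = min{t*lam : P_t contains an optimum} (T = \<infinity> if never):
  since T takes values in lam*\<nat> \<union> {\<infinity>}, E[T] = \<Sum>_t lam * Pr[P_0,...,P_t contain no optimum].\<close>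
definition expected_runtime :: "nat \<Rightarrow> (bool list \<Rightarrow> real) \<Rightarrow> nat \<Rightarrow> real \<Rightarrow> ennreal" where
  "expected_runtime n f lam p =
     (\<Sum>t. ennreal (real lam) * ennreal (measure_pmf.prob (ea_state n f lam p t) {s. \<not> snd s}))"

definition decomp :: "nat \<Rightarrow> (nat \<Rightarrow> nat) \<Rightarrow> (nat \<Rightarrow> bool list \<Rightarrow> bool) \<Rightarrow> bool list \<Rightarrow> real" where
  "decomp N a F x = (\<Sum>l = 1..N. real (a l) * (if F l x then 1 else 0))"

definition decomp_instance ::
  "nat \<Rightarrow> nat \<Rightarrow> (nat \<Rightarrow> nat set) \<Rightarrow> (nat \<Rightarrow> bool list \<Rightarrow> bool) \<Rightarrow> (nat \<Rightarrow> nat) \<Rightarrow> nat \<Rightarrow> bool" where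
  "decomp_instance n N \<sigma> F a r \<longleftrightarrow>
     (\<Union>l\<in>{1..N}. \<sigma> l) = {..<n} \<and>
     (\<forall>l\<in>{1..N}. \<forall>l'\<in>{1..N}. l \<noteq> l' \<longrightarrow> \<sigma> l \<inter> \<sigma> l' = {}) \<and>
     (\<forall>l\<in>{1..N}. \<sigma> l \<noteq> {} \<and> card (\<sigma> l) \<le> r) \<and>
     (\<forall>l\<in>{1..N}. \<forall>x y. length x = n \<longrightarrow> length y = n \<longrightarrow>
          (\<forall>i\<in>\<sigma> l. x ! i = y ! i) \<longrightarrow> F l x = F l y) \<and>
     (\<forall>l\<in>{1..N}. \<exists>x. length x = n \<and> F l x) \<and>
     (\<forall>l. 1 \<le> l \<longrightarrow> l < N \<longrightarrow> a (Suc l) \<le> a l) \<and>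
     0 < a N"

end

theory Submission
  imports Defs
begin

text \<open>Order the search space into levels: level \<open>j\<close> collects the strings of fitness at least
  \<open>a 1 + \<dots> + a j\<close>. Since the weights are integers, fitness-proportionate selection favours
  the strings of any level by a factor that outweighs the loss by mutation, so a level occupied
  by less than a fraction \<open>c / 2\<close> of the population grows by a factor \<open>1 + \<delta>\<close> with
  \<open>\<delta> = c / (2 n a 1)\<close>. Conversely, a level holding that fraction is lost in one generation
  only with probability \<open>exp (- \<Omega>(\<delta>\<^sup>2 lam))\<close>.

  The occupation number of a level is a sum of independent indicators, hence its exponential
  moments are explicit. A weighted sum of the functions \<open>1 - exp (- \<theta> x)\<close> over the dyadic rates
  \<open>\<theta> = \<delta> / 2, \<delta> / 4, \<dots>\<close> therefore has drift at least \<open>1\<close> in the occupation number \<open>x\<close> of the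
  next level, while its range is only \<open>O(log lam / \<delta> + 1 / (\<delta> lam z))\<close>, where \<open>z\<close> is the
  probability of producing an offspring in the next level. Stacking these functions over the
  levels gives one bounded potential of the whole population with constant drift, and the
  additive drift argument bounds the expected number of generations by its range.\<close>

subsection \<open>Exponential moments, mutation and selection\<close>

lemma expectation_bind_pmf_bounded:
  fixes g :: "'b \<Rightarrow> real"
  assumes "\<And>x. \<bar>g x\<bar> \<le> B"
  shows "measure_pmf.expectation (bind_pmf M N) g
       = measure_pmf.expectation M (\<lambda>x. measure_pmf.expectation (N x) g)"
  unfolding measure_pmf_bind
  by (rule integral_bind[where K = "count_space UNIV" and B' = 1 and B = B])
     (use assms in \<open>auto simp: measure_pmf.emeasure_space_1[simplified] measure_pmf.finite_measure
      measure_pmf_in_subprob_algebra\<close>)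

lemma integrable_measure_pmf_bounded:
  fixes g :: "'b \<Rightarrow> real"
  assumes "\<And>x. x \<in> set_pmf M \<Longrightarrow> \<bar>g x\<bar> \<le> B"
  shows "integrable (measure_pmf M) g"
  by (rule measure_pmf.integrable_const_bound[where B = B])
     (use assms in \<open>auto simp: AE_measure_pmf_iff\<close>)

lemma prob_bind_pmf:
  "measure_pmf.prob (bind_pmf M N) A = measure_pmf.expectation M (\<lambda>x. measure_pmf.prob (N x) A)"
  using expectation_bind_pmf_bounded[of "indicator A" 1 M N] by (simp add: indicator_def)

lemma set_pmf_iid_list:
  "xs \<in> set_pmf (iid_list k D) \<Longrightarrow> length xs = k \<and> set xs \<subseteq> set_pmf D"
  by (induction k arbitrary: xs) fastforce+

lemma expectation_iid_list_exp_count: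
  fixes \<theta> :: real
  assumes "0 \<le> \<theta>"
  shows "measure_pmf.expectation (iid_list k D) (\<lambda>xs. exp (- \<theta> * real (length (filter (\<lambda>x. x \<in> A) xs))))
       = (1 - measure_pmf.prob D A * (1 - exp (- \<theta>))) ^ k"
proof (induction k)
  case (Suc k)
  let ?g = "\<lambda>xs. exp (- \<theta> * real (length (filter (\<lambda>x. x \<in> A) xs)))"
  let ?u = "\<lambda>x. 1 - indicator A x * (1 - exp (- \<theta>))"
  have step: "measure_pmf.expectation (map_pmf ((#) x) (iid_list k D)) ?g
      = ?u x * (1 - measure_pmf.prob D A * (1 - exp (- \<theta>))) ^ k" for x
  proof -
    have "?g (x # xs) = ?u x * ?g xs" for xs
      by (auto simp: indicator_def algebra_simps simp flip: exp_add)
    then show ?thesis using Suc by simp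
  qed
  have "measure_pmf.expectation (iid_list (Suc k) D) ?g
      = measure_pmf.expectation D (\<lambda>x. ?u x * (1 - measure_pmf.prob D A * (1 - exp (- \<theta>))) ^ k)"
    unfolding iid_list.simps step[symmetric]
    by (rule expectation_bind_pmf_bounded[where B = 1]) (use assms in \<open>simp add: mult_nonneg_nonneg\<close>)
  also have "\<dots> = measure_pmf.expectation D ?u * (1 - measure_pmf.prob D A * (1 - exp (- \<theta>))) ^ k"
    by simp
  also have "measure_pmf.expectation D ?u = 1 - measure_pmf.prob D A * (1 - exp (- \<theta>))"
    by (subst Bochner_Integration.integral_diff)
       (auto intro!: integrable_measure_pmf_bounded[where B = 1] simp: assms split: split_indicator)
  finally show ?case by simp
qed simp

lemma one_minus_exp_ge:
  fixes t :: real
  assumes "0 \<le> t"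
  shows "t - t\<^sup>2 / 2 \<le> 1 - exp (- t)"
proof -
  have "exp (- t) \<le> 1 - t + t\<^sup>2 / 2"
  proof -
    let ?f = "\<lambda>t::real. 1 - t + t\<^sup>2 / 2 - exp (- t)"
    have "?f 0 \<le> ?f t"
    proof (rule DERIV_nonneg_imp_nondecreasing[OF assms])
      fix x :: real
      have "(?f has_real_derivative (x - 1 + exp (- x))) (at x)"
        by (auto intro!: derivative_eq_intros)
      moreover have "0 \<le> x - 1 + exp (- x)"
        using exp_ge_add_one_self[of "- x"] by simp
      ultimately show "\<exists>y. (?f has_real_derivative y) (at x) \<and> 0 \<le> y" by blast
    qed
    then show ?thesis by simp
  qed
  then show ?thesis by simp
qed

lemma expectation_iid_list_exp_count_le:
  fixes \<theta> \<delta> w x :: real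
  assumes "0 \<le> \<theta>" "\<theta> \<le> \<delta> / 2" "\<delta> \<le> 1" "0 \<le> x" "0 \<le> w"
    and q: "(1 + \<delta>) * x + w \<le> real k * measure_pmf.prob D A"
  shows "measure_pmf.expectation (iid_list k D) (\<lambda>xs. exp (- \<theta> * real (length (filter (\<lambda>x. x \<in> A) xs))))
       \<le> exp (- \<theta> * x) * exp (- (\<theta> * x * \<delta> / 2)) * exp (- (w * \<theta> / 2))"
proof -
  let ?q = "measure_pmf.prob D A" and ?s = "1 - exp (- \<theta>)"
  have s1: "\<theta> - \<theta>\<^sup>2 / 2 \<le> ?s" using one_minus_exp_ge assms(1) by blast
  have s0: "0 \<le> ?s" using assms by simp
  have d0: "0 \<le> \<delta>" using assms by simp
  have "\<theta> * (1 + \<delta> / 2) \<le> (1 + \<delta>) * (\<theta> - \<theta>\<^sup>2 / 2)"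
  proof -
    have "\<theta> * ((1 + \<delta>) * \<theta>) \<le> \<theta> * \<delta>"
    proof (rule mult_left_mono)
      have "(1 + \<delta>) * \<theta> \<le> 2 * (\<delta> / 2)" using assms d0 by (intro mult_mono) auto
      then show "(1 + \<delta>) * \<theta> \<le> \<delta>" by simp
    qed (use assms in auto)
    then show ?thesis by (simp add: field_simps power2_eq_square)
  qed
  also have "\<dots> \<le> (1 + \<delta>) * ?s" using s1 d0 by (intro mult_left_mono) auto
  finally have a: "\<theta> * (1 + \<delta> / 2) * x \<le> (1 + \<delta>) * ?s * x" using assms by (intro mult_right_mono)
  have "\<theta> * \<theta> \<le> \<theta> * 1" using assms by (intro mult_left_mono) auto
  then have "\<theta> / 2 \<le> ?s" using s1 by (simp add: power2_eq_square)
  then have b: "w * (\<theta> / 2) \<le> w * ?s" using assms by (intro mult_left_mono)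
  have "((1 + \<delta>) * x + w) * ?s \<le> real k * ?q * ?s" using q s0 by (intro mult_right_mono)
  then have c: "\<theta> * x + \<theta> * x * \<delta> / 2 + w * \<theta> / 2 \<le> real k * (?q * ?s)"
    using a b by (simp add: algebra_simps)
  have "?q * ?s \<le> 1 * 1" using s0 by (intro mult_mono) auto
  then have "(1 - ?q * ?s) ^ k \<le> exp (- (?q * ?s)) ^ k"
    using exp_ge_add_one_self[of "- (?q * ?s)"] by (intro power_mono) auto
  also have "\<dots> = exp (- (real k * (?q * ?s)))" by (simp flip: exp_of_nat_mult)
  also have "\<dots> \<le> exp (- (\<theta> * x + \<theta> * x * \<delta> / 2 + w * \<theta> / 2))" using c by simp
  also have "\<dots> = exp (- \<theta> * x) * exp (- (\<theta> * x * \<delta> / 2)) * exp (- (w * \<theta> / 2))"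
    by (simp flip: exp_add)
  finally show ?thesis by (simp only: expectation_iid_list_exp_count[OF assms(1)])
qed

lemma pmf_mutate_ge:
  assumes "0 \<le> p" "p \<le> 1" "length y = length x"
  shows "p ^ card {i. i < length x \<and> x ! i \<noteq> y ! i} * (1 - p) ^ length x \<le> pmf (mutate p x) y"
proof -
  have "p ^ length (filter (\<lambda>(a, b). a \<noteq> b) (zip x y)) * (1 - p) ^ length x \<le> pmf (mutate p x) y"
    using assms(3)[symmetric]
  proof (induction x y rule: list_induct2)
    case (Cons x xs y ys)
    have *: "pmf (map_pmf ((#) a) (mutate p xs)) (y # ys) = (if a = y then pmf (mutate p xs) ys else 0)" for a
    proof (cases "a = y")
      case True
      then show ?thesis by (simp add: pmf_map_inj')
    next
      case False
      then show ?thesis by (auto simp: pmf_eq_0_set_pmf)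
    qed
    have "pmf (mutate p (x # xs)) (y # ys) = (if x \<noteq> y then p else 1 - p) * pmf (mutate p xs) ys"
      using assms by (auto simp: pmf_bind integral_bernoulli_pmf *)
    moreover have "p * p ^ k * ((1 - p) * (1 - p) ^ length xs) \<le> p * W"
      "p ^ k * ((1 - p) * (1 - p) ^ length xs) \<le> (1 - p) * W"
      if W: "p ^ k * (1 - p) ^ length xs \<le> W" for k W
    proof -
      have "(1 - p) * (p ^ k * (1 - p) ^ length xs) \<le> p ^ k * (1 - p) ^ length xs"
        using assms by (intro mult_left_le_one_le) auto
      then have "p * ((1 - p) * (p ^ k * (1 - p) ^ length xs)) \<le> p * W"
        using W assms by (intro mult_left_mono) auto
      then show "p * p ^ k * ((1 - p) * (1 - p) ^ length xs) \<le> p * W" by (simp add: ac_simps)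
      show "p ^ k * ((1 - p) * (1 - p) ^ length xs) \<le> (1 - p) * W"
        using mult_left_mono[OF W, of "1 - p"] assms by (simp add: ac_simps)
    qed
    ultimately show ?case using Cons.IH by (auto simp del: mutate.simps)
  qed simp
  also have "length (filter (\<lambda>(a, b). a \<noteq> b) (zip x y)) = card {i. i < length x \<and> x ! i \<noteq> y ! i}"
    using assms by (auto simp: length_filter_conv_card intro!: arg_cong[where f = card])
  finally show ?thesis .
qed

lemma length_mutate: "y \<in> set_pmf (mutate p x) \<Longrightarrow> length y = length x"
  by (induction x arbitrary: y) auto

lemma pmf_fp_select:
  assumes nonneg: "\<And>x. 0 \<le> f x" and S: "(\<Sum>i<length P. f (P ! i)) \<noteq> 0"
  shows "pmf (fp_select f P) i = (if i < length P then f (P ! i) / (\<Sum>i<length P. f (P ! i)) else 0)"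
proof -
  let ?S = "\<Sum>i<length P. f (P ! i)"
  let ?g = "\<lambda>i. if i < length P then f (P ! i) / ?S else 0"
  have S0: "0 < ?S" using S sum_nonneg[of "{..<length P}" "\<lambda>i. f (P ! i)"] nonneg by force
  have "(\<integral>\<^sup>+i. ennreal (?g i) \<partial>count_space UNIV) = (\<Sum>i<length P. ennreal (?g i))"
    by (rule nn_integral_count_space') (auto split: if_splits)
  also have "\<dots> = ennreal (\<Sum>i<length P. f (P ! i) / ?S)"
    using S0 nonneg by (subst sum_ennreal[symmetric]) auto
  also have "(\<Sum>i<length P. f (P ! i) / ?S) = 1"
    using S0 by (simp flip: sum_divide_distrib)
  finally have "(\<integral>\<^sup>+i. ennreal (?g i) \<partial>count_space UNIV) = 1" by simp
  then have "pmf (embed_pmf ?g) i = ?g i"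
    using S0 nonneg by (intro pmf_embed_pmf) auto
  then show ?thesis using S by (simp add: fp_select_def Let_def)
qed

lemma set_fp_select:
  assumes "\<And>x. 0 \<le> f x" "P \<noteq> []" "i \<in> set_pmf (fp_select f P)"
  shows "i < length P"
proof (cases "(\<Sum>i<length P. f (P ! i)) = 0")
  case True
  then show ?thesis using assms by (auto simp: fp_select_def Let_def lessThan_empty_iff)
next
  case False
  then show ?thesis using assms pmf_fp_select[of f P i] by (auto simp: set_pmf_iff split: if_splits)
qed

lemma prob_fp_select_ge:
  fixes s :: real
  assumes nonneg: "\<And>x. 0 \<le> f x" and gap: "\<And>x. x \<in> set P \<Longrightarrow> s \<le> f x \<or> f x \<le> s - 1"
    and s: "1 \<le> s" and X: "X = real (length (filter (\<lambda>x. s \<le> f x) P))"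
  shows "X * s / (X + real (length P) * (s - 1))
       \<le> measure_pmf.prob (fp_select f P) {i. i < length P \<and> s \<le> f (P ! i)}"
proof (cases "X = 0")
  case False
  define I where "I = {i. i < length P \<and> s \<le> f (P ! i)}"
  define J where "J = {i. i < length P \<and> \<not> s \<le> f (P ! i)}"
  define U where "U = (\<Sum>i\<in>I. f (P ! i))"
  define V where "V = (\<Sum>i\<in>J. f (P ! i))"
  have fin: "finite I" "finite J" "I \<inter> J = {}" "I \<union> J = {..<length P}"
    by (auto simp: I_def J_def)
  have XI: "X = real (card I)" unfolding X I_def by (simp add: length_filter_conv_card)
  have len: "length P = card I + card J"
    using card_Un_disjoint[OF fin(1-3)] fin(4) by simp
  have S: "(\<Sum>i<length P. f (P ! i)) = U + V"
    unfolding U_def V_def using fin sum.union_disjoint[OF fin(1-3), of "\<lambda>i. f (P ! i)"] by simp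
  have U: "X * s \<le> U"
    using sum_bounded_below[of I s "\<lambda>i. f (P ! i)"] by (auto simp: U_def XI I_def)
  have V: "V \<le> real (card J) * (s - 1)"
    unfolding V_def by (rule sum_bounded_above) (use gap in \<open>force simp: J_def\<close>)
  have V0: "0 \<le> V" unfolding V_def using nonneg by (intro sum_nonneg) auto
  have X0: "0 < X" using False XI by simp
  have Xs: "0 < X * s" using X0 s by simp
  then have U0: "0 < U" using U by simp
  have "measure_pmf.prob (fp_select f P) I = (\<Sum>i\<in>I. f (P ! i) / (U + V))"
    unfolding measure_measure_pmf_finite[OF fin(1)] using pmf_fp_select[of f P] nonneg U0 V0 S
    by (intro sum.cong) (auto simp: I_def)
  also have "\<dots> = U / (U + V)" by (simp add: U_def sum_divide_distrib)
  finally have prob: "measure_pmf.prob (fp_select f P) I = U / (U + V)" .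
  have den: "X + real (length P) * (s - 1) = X * s + real (card J) * (s - 1)"
    by (simp add: len XI algebra_simps)
  have "X * s * V \<le> U * (real (card J) * (s - 1))"
    using U V V0 Xs U0 by (intro mult_mono) auto
  then have "X * s * (U + V) \<le> U * (X * s + real (card J) * (s - 1))"
    by (simp add: algebra_simps)
  moreover have "0 < X * s + real (card J) * (s - 1)" using Xs s by (simp add: add_pos_nonneg)
  ultimately have "X * s / (X * s + real (card J) * (s - 1)) \<le> U / (U + V)"
    using U0 V0 by (simp add: divide_le_eq le_divide_eq mult.commute)
  then show ?thesis using prob den by (simp add: I_def)
qed simp

subsection \<open>Drift of the level potential\<close>

abbreviation count_in :: "'a set \<Rightarrow> 'a list \<Rightarrow> nat" where
  "count_in A xs \<equiv> length (filter (\<lambda>x. x \<in> A) xs)"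

lemma one_minus_exp_ge_half:
  fixes u :: real
  assumes "0 \<le> u" "u \<le> 1"
  shows "u / 2 \<le> 1 - exp (- u)"
proof -
  have "u * u \<le> u * 1" using assms by (intro mult_left_mono) auto
  then show ?thesis using one_minus_exp_ge[OF assms(1)] by (simp add: power2_eq_square)
qed

lemma one_minus_exp_mult_ge:
  fixes u :: real
  assumes "0 < u"
  shows "1 \<le> (1 + 1 / u) * (1 - exp (- u))"
proof -
  have "1 + u \<le> exp u" using exp_ge_add_one_self by simp
  then have "exp (- u) \<le> 1 / (1 + u)" using assms by (simp add: exp_minus field_simps)
  then have "(1 + 1 / u) * (1 - 1 / (1 + u)) \<le> (1 + 1 / u) * (1 - exp (- u))"
    using assms by (intro mult_left_mono) auto
  moreover have "(1 + 1 / u) * (1 - 1 / (1 + u)) = 1"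
    using assms add_pos_pos[OF assms mult_pos_pos[OF assms assms]] by (simp add: field_simps)
  ultimately show ?thesis by simp
qed

locale level_process =
  fixes D :: "'a list \<Rightarrow> 'a pmf" and V :: "'a list set" and A :: "nat \<Rightarrow> 'a set"
    and lam m K :: nat and \<gamma> \<delta> z :: real
  assumes length_V: "P \<in> V \<Longrightarrow> length P = lam"
    and level_0: "P \<in> V \<Longrightarrow> set P \<subseteq> A 0"
    and V_closed: "P \<in> V \<Longrightarrow> set_pmf (iid_list lam (D P)) \<subseteq> V"
    and \<delta>: "0 < \<delta>" "\<delta> \<le> 1" and \<gamma>: "0 < \<gamma>" "\<gamma> \<le> 1" and z: "0 < z"
    and lam: "8 \<le> \<gamma> * \<delta> * real lam" "lam \<le> 2 ^ K"
    and growth: "\<lbrakk>P \<in> V; 1 \<le> j; j \<le> m\<rbrakk> \<Longrightarrow>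
      (1 + \<delta>) * min (real (count_in (A j) P)) (\<gamma> * real lam) \<le> real lam * measure_pmf.prob (D P) (A j)"
    and upgrade: "\<lbrakk>P \<in> V; j < m; \<gamma> * real lam \<le> real (count_in (A j) P);
        real (count_in (A (Suc j)) P) \<le> \<gamma> * real lam / 8\<rbrakk> \<Longrightarrow>
      (1 + \<delta>) * real (count_in (A (Suc j)) P) + real lam * z \<le> real lam * measure_pmf.prob (D P) (A (Suc j))"
begin

abbreviation \<theta> :: "nat \<Rightarrow> real" where "\<theta> k \<equiv> \<delta> / 2 / 2 ^ k"

definition h :: "nat \<Rightarrow> real" where
  "h x = 8 * exp 1 / \<delta> * (\<Sum>k\<le>K. 1 - exp (- \<theta> k * real x))
       + exp 1 * (1 + 4 / (real lam * z * \<delta>)) * (1 - exp (- (\<delta> / 2) * real x))"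

definition H :: real where
  "H = 8 * exp 1 / \<delta> * real (Suc K) + exp 1 * (1 + 4 / (real lam * z * \<delta>))"

definition level :: "'a list \<Rightarrow> nat" where
  "level P = Max {j. j \<le> m \<and> \<gamma> * real lam \<le> real (count_in (A j) P)}"

definition potential :: "'a list \<Rightarrow> real" where
  "potential P = real (level P) * H + h (if level P < m then count_in (A (Suc (level P))) P else 0)"

lemma lam_pos: "0 < real lam"
  using lam(1) by (cases "lam = 0") auto

lemma h_nonneg: "0 \<le> h x"
  unfolding h_def using \<delta> z lam_pos by (intro add_nonneg_nonneg mult_nonneg_nonneg sum_nonneg) auto

lemma h_le: "h x \<le> H"
proof -
  have "(\<Sum>k\<le>K. 1 - exp (- \<theta> k * real x)) \<le> real (Suc K)"
    using sum_bounded_above[of "{..K}" "\<lambda>k. 1 - exp (- \<theta> k * real x)" 1] by simp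
  moreover have "exp 1 * (1 + 4 / (real lam * z * \<delta>)) * (1 - exp (- (\<delta> / 2) * real x))
      \<le> exp 1 * (1 + 4 / (real lam * z * \<delta>))"
    using \<delta> z lam_pos by (intro mult_left_le) auto
  ultimately show ?thesis
    unfolding h_def H_def using \<delta> by (intro add_mono mult_left_mono) auto
qed

lemma H_nonneg: "0 \<le> H"
  using h_nonneg[of 0] h_le[of 0] by simp

lemma \<theta>_bounds: "0 \<le> \<theta> k" "\<theta> k \<le> \<delta> / 2"
proof -
  show "0 \<le> \<theta> k" using \<delta> by simp
  have "\<delta> / 2 / 2 ^ k \<le> \<delta> / 2 / 1" using \<delta> by (intro divide_left_mono) auto
  then show "\<theta> k \<le> \<delta> / 2" by simp
qed

lemma expectation_h:
  "measure_pmf.expectation M (\<lambda>Q. h (g Q))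
   = 8 * exp 1 / \<delta> * (\<Sum>k\<le>K. 1 - measure_pmf.expectation M (\<lambda>Q. exp (- \<theta> k * real (g Q))))
     + exp 1 * (1 + 4 / (real lam * z * \<delta>))
         * (1 - measure_pmf.expectation M (\<lambda>Q. exp (- (\<delta> / 2) * real (g Q))))"
proof -
  have int: "integrable (measure_pmf M) (\<lambda>Q. exp (- t * real (g Q)))" if "0 \<le> t" for t
    using that by (intro integrable_measure_pmf_bounded[where B = 1]) auto
  have 1: "integrable (measure_pmf M) (\<lambda>Q. 1 - exp (- t * real (g Q)))" if "0 \<le> t" for t
    using int[OF that] by auto
  have 2: "measure_pmf.expectation M (\<lambda>Q. 1 - exp (- t * real (g Q)))
      = 1 - measure_pmf.expectation M (\<lambda>Q. exp (- t * real (g Q)))" if "0 \<le> t" for t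
    using int[OF that] by (subst Bochner_Integration.integral_diff) auto
  have lin: "measure_pmf.expectation M (\<lambda>Q. a * (\<Sum>k\<le>K. F k Q) + b * F' Q)
      = a * (\<Sum>k\<le>K. measure_pmf.expectation M (F k)) + b * measure_pmf.expectation M F'"
    if "\<And>k. integrable (measure_pmf M) (F k)" "integrable (measure_pmf M) F'"
    for a b :: real and F F'
    using that by simp
  have \<delta>2: "0 \<le> \<delta> / 2" using \<delta> by simp
  show ?thesis
    unfolding h_def lin[OF 1[OF \<theta>_bounds(1)] 1[OF \<delta>2]] 2[OF \<theta>_bounds(1)] 2[OF \<delta>2] ..
qed

text \<open>For \<open>x > 1/\<delta>\<close> the dyadic rate with \<open>\<theta> k * x\<close> of constant order contributes drift
  of order \<open>\<delta>\<close>; for \<open>x \<le> 1/\<delta>\<close> the upgrades alone move the summand of rate \<open>\<delta> / 2\<close>.\<close>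

lemma h_drift:
  assumes P: "P \<in> V" and j: "j < m" and full: "\<gamma> * real lam \<le> real (count_in (A j) P)"
    and less: "real (count_in (A (Suc j)) P) < \<gamma> * real lam"
  shows "h (count_in (A (Suc j)) P) + 1
       \<le> measure_pmf.expectation (iid_list lam (D P)) (\<lambda>Q. h (count_in (A (Suc j)) Q))"
proof -
  define x where "x = count_in (A (Suc j)) P"
  define E where "E t = measure_pmf.expectation (iid_list lam (D P))
    (\<lambda>Q. exp (- t * real (count_in (A (Suc j)) Q)))" for t
  define C where "C = exp 1 * (1 + 4 / (real lam * z * \<delta>))"
  have C0: "0 < C" unfolding C_def using \<delta> z lam_pos by (intro mult_pos_pos add_pos_pos) auto
  have q: "(1 + \<delta>) * real x + 0 \<le> real lam * measure_pmf.prob (D P) (A (Suc j))"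
    using growth[OF P, of "Suc j"] j less by (simp add: x_def min_def)
  have E1: "E t \<le> exp (- t * real x) * exp (- (t * real x * \<delta> / 2))" if "0 \<le> t" "t \<le> \<delta> / 2" for t
    using expectation_iid_list_exp_count_le[OF that \<delta>(2) _ _ q] by (simp add: E_def)
  have E2: "E t \<le> exp (- t * real x)" if "0 \<le> t" "t \<le> \<delta> / 2" for t
  proof -
    have "exp (- t * real x) * exp (- (t * real x * \<delta> / 2)) \<le> exp (- t * real x)"
      using that \<delta> by (intro mult_left_le) auto
    then show ?thesis using E1[OF that] by linarith
  qed
  define d where "d k = exp (- \<theta> k * real x) - E (\<theta> k)" for k
  define d' where "d' = exp (- (\<delta> / 2) * real x) - E (\<delta> / 2)"
  have d0: "0 \<le> d k" for k unfolding d_def using E2[OF \<theta>_bounds] by simp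
  have d'0: "0 \<le> d'" unfolding d'_def using E2[of "\<delta> / 2"] \<delta> by simp
  have diff: "measure_pmf.expectation (iid_list lam (D P)) (\<lambda>Q. h (count_in (A (Suc j)) Q)) - h x
      = 8 * exp 1 / \<delta> * (\<Sum>k\<le>K. d k) + C * d'"
    unfolding expectation_h unfolding h_def C_def d_def d'_def E_def
    by (simp add: sum_subtractf right_diff_distrib)
  have "1 \<le> 8 * exp 1 / \<delta> * (\<Sum>k\<le>K. d k) + C * d'"
  proof (cases "real x \<le> 1 / \<delta>")
    case True
    have "1 / \<delta> \<le> \<gamma> * real lam / 8" using lam(1) \<delta> by (simp add: field_simps)
    then have "(1 + \<delta>) * real x + real lam * z \<le> real lam * measure_pmf.prob (D P) (A (Suc j))"
      using True upgrade[OF P j full] by (simp add: x_def)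
    from expectation_iid_list_exp_count_le[OF _ _ \<delta>(2) _ _ this, of "\<delta> / 2"]
    have "E (\<delta> / 2) \<le> exp (- (\<delta> / 2) * real x) * exp (- (\<delta> / 2 * real x * \<delta> / 2))
        * exp (- (real lam * z * (\<delta> / 2) / 2))"
      using \<delta> z by (simp add: E_def)
    also have "\<dots> \<le> exp (- (\<delta> / 2) * real x) * exp (- (real lam * z * (\<delta> / 2) / 2))"
      using \<delta> by (intro mult_right_mono mult_left_le) auto
    finally have d'1: "exp (- (\<delta> / 2) * real x) * (1 - exp (- (real lam * z * \<delta> / 4))) \<le> d'"
      by (simp add: d'_def algebra_simps)
    have "exp (- 1) \<le> exp (- (\<delta> / 2) * real x)" using True \<delta> by (simp add: field_simps)
    then have "exp (- 1) * (1 - exp (- (real lam * z * \<delta> / 4)))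
        \<le> exp (- (\<delta> / 2) * real x) * (1 - exp (- (real lam * z * \<delta> / 4)))"
      using \<delta> z by (intro mult_right_mono) auto
    then have "exp (- 1) * (1 - exp (- (real lam * z * \<delta> / 4))) \<le> d'" using d'1 by linarith
    then have "C * (exp (- 1) * (1 - exp (- (real lam * z * \<delta> / 4)))) \<le> C * d'"
      using C0 by (intro mult_left_mono) auto
    moreover have "C * (exp (- 1) * (1 - exp (- (real lam * z * \<delta> / 4))))
        = (1 + 1 / (real lam * z * \<delta> / 4)) * (1 - exp (- (real lam * z * \<delta> / 4)))"
      unfolding C_def by (simp add: exp_minus)
    moreover have "1 \<le> (1 + 1 / (real lam * z * \<delta> / 4)) * (1 - exp (- (real lam * z * \<delta> / 4)))"
      using \<delta> z lam_pos by (intro one_minus_exp_mult_ge) auto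
    ultimately have "1 \<le> C * d'" by linarith
    moreover have "0 \<le> 8 * exp 1 / \<delta> * (\<Sum>k\<le>K. d k)"
      using \<delta> d0 by (intro mult_nonneg_nonneg sum_nonneg) auto
    ultimately show ?thesis by simp
  next
    case False
    define k where "k = (LEAST k. \<theta> k * real x \<le> 1)"
    have "real x \<le> real lam" using length_V[OF P] length_filter_le[of _ P] by (simp add: x_def)
    also have "\<dots> \<le> 2 ^ K" using lam(2) by (metis of_nat_le_iff of_nat_numeral of_nat_power)
    finally have xK: "real x \<le> 2 ^ K" .
    have "\<theta> K * real x \<le> \<theta> K * 2 ^ K" using xK \<delta> by (intro mult_left_mono) auto
    also have "\<dots> \<le> 1" using \<delta> by simp
    finally have K1: "\<theta> K * real x \<le> 1" .
    have k1: "\<theta> k * real x \<le> 1" unfolding k_def using K1 by (rule LeastI)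
    have kK: "k \<le> K" unfolding k_def using K1 by (rule Least_le)
    have k2: "1 / 2 \<le> \<theta> k * real x"
    proof (cases k)
      case 0
      then show ?thesis using False \<delta> by (simp add: field_simps)
    next
      case (Suc k')
      then have "\<not> \<theta> k' * real x \<le> 1" unfolding k_def using not_less_Least[of k'] by (metis lessI)
      then show ?thesis using Suc by simp
    qed
    define u where "u = \<theta> k * real x * \<delta> / 2"
    have u1: "u \<le> 1"
      unfolding u_def
      using divide_right_mono[OF mult_mono[OF k1 \<delta>(2) zero_le_one less_imp_le[OF \<delta>(1)]], of 2]
      by (rule order_trans) simp_all
    have u2: "\<delta> / 4 \<le> u" using mult_right_mono[OF k2, of "\<delta> / 2"] \<delta> by (simp add: u_def)
    have u3: "\<delta> / 8 \<le> 1 - exp (- u)" using one_minus_exp_ge_half[of u] u1 u2 \<delta> by linarith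
    have "exp (- 1) * (\<delta> / 8) \<le> exp (- \<theta> k * real x) * (1 - exp (- u))"
      using k1 u3 \<delta> by (intro mult_mono) auto
    also have "\<dots> \<le> d k" using E1[OF \<theta>_bounds[of k]] by (simp add: d_def u_def right_diff_distrib)
    also have "\<dots> \<le> (\<Sum>k\<le>K. d k)" using kK d0 by (intro member_le_sum) auto
    finally have "8 * exp 1 / \<delta> * (exp (- 1) * (\<delta> / 8)) \<le> 8 * exp 1 / \<delta> * (\<Sum>k\<le>K. d k)"
      using \<delta> by (intro mult_left_mono) auto
    moreover have "8 * exp 1 / \<delta> * (exp (- 1) * (\<delta> / 8)) = 1" using \<delta> by (simp add: exp_minus)
    moreover have "0 \<le> C * d'" using C0 d'0 by simp
    ultimately show ?thesis by linarith
  qed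
  then show ?thesis using diff by (simp add: x_def)
qed

lemma prob_level_lost:
  assumes P: "P \<in> V" and j: "1 \<le> j" "j \<le> m" and full: "\<gamma> * real lam \<le> real (count_in (A j) P)"
  shows "measure_pmf.prob (iid_list lam (D P)) {Q. real (count_in (A j) Q) < \<gamma> * real lam}
       \<le> exp (- (\<gamma> * real lam * \<delta>\<^sup>2 / 4))"
proof -
  let ?M = "iid_list lam (D P)" and ?x = "\<gamma> * real lam"
  let ?B = "{Q. real (count_in (A j) Q) < ?x}"
  have q: "(1 + \<delta>) * ?x + 0 \<le> real lam * measure_pmf.prob (D P) (A j)"
    using growth[OF P j] full by (simp add: min_def split: if_splits)
  have "exp (- (\<delta> / 2) * ?x) * measure_pmf.prob ?M ?B
      = measure_pmf.expectation ?M (\<lambda>Q. exp (- (\<delta> / 2) * ?x) * indicator ?B Q)"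
    by simp
  also have "\<dots> \<le> measure_pmf.expectation ?M (\<lambda>Q. exp (- (\<delta> / 2) * real (count_in (A j) Q)))"
  proof (rule integral_mono)
    show "integrable (measure_pmf ?M) (\<lambda>Q. exp (- (\<delta> / 2) * ?x) * indicator ?B Q)"
      by (rule integrable_measure_pmf_bounded[where B = 1])
         (use \<delta> \<gamma> in \<open>auto split: split_indicator\<close>)
    show "integrable (measure_pmf ?M) (\<lambda>Q. exp (- (\<delta> / 2) * real (count_in (A j) Q)))"
      by (rule integrable_measure_pmf_bounded[where B = 1]) (use \<delta> in auto)
  qed (use \<delta> in \<open>auto split: split_indicator\<close>)
  also have "\<dots> \<le> exp (- (\<delta> / 2) * ?x) * exp (- (\<delta> / 2 * ?x * \<delta> / 2)) * exp (- (0 * (\<delta> / 2) / 2))"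
    by (rule expectation_iid_list_exp_count_le[OF _ _ _ _ _ q]) (use \<delta> \<gamma> in auto)
  finally have "measure_pmf.prob ?M ?B \<le> exp (- (\<delta> / 2 * ?x * \<delta> / 2))" by simp
  then show ?thesis by (simp add: power2_eq_square algebra_simps)
qed

lemma level_props:
  assumes "P \<in> V"
  shows "level P \<le> m" "\<gamma> * real lam \<le> real (count_in (A (level P)) P)"
    and "\<And>j. j \<le> m \<Longrightarrow> \<gamma> * real lam \<le> real (count_in (A j) P) \<Longrightarrow> j \<le> level P"
proof -
  let ?S = "{j. j \<le> m \<and> \<gamma> * real lam \<le> real (count_in (A j) P)}"
  have fin: "finite ?S" by (rule finite_subset[of _ "{..m}"]) auto
  have "filter (\<lambda>x. x \<in> A 0) P = P" using level_0[OF assms] by (auto simp: filter_id_conv)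
  then have "\<gamma> * real lam \<le> real (count_in (A 0) P)"
    using length_V[OF assms] \<gamma> by (simp add: mult_left_le_one_le)
  then have "?S \<noteq> {}" by blast
  from Max_in[OF fin this] show "level P \<le> m" "\<gamma> * real lam \<le> real (count_in (A (level P)) P)"
    by (auto simp: level_def)
  show "j \<le> level P" if "j \<le> m" "\<gamma> * real lam \<le> real (count_in (A j) P)" for j
    unfolding level_def using fin that by (intro Max_ge) auto
qed

lemma potential_bounds:
  assumes "P \<in> V"
  shows "0 \<le> potential P" "potential P \<le> real (Suc m) * H"
proof -
  show "0 \<le> potential P" unfolding potential_def using H_nonneg h_nonneg by simp
  have "real (level P) * H \<le> real m * H"
    using level_props(1)[OF assms] H_nonneg by (intro mult_right_mono) auto
  then show "potential P \<le> real (Suc m) * H"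
    unfolding potential_def using h_le[of "if level P < m then count_in (A (Suc (level P))) P else 0"]
    by (simp only: of_nat_Suc distrib_right mult_1)
qed

lemma potential_drift:
  assumes P: "P \<in> V" and L: "level P < m"
  shows "potential P + 1 - exp (- (\<gamma> * real lam * \<delta>\<^sup>2 / 4)) * (real (Suc m) * H)
       \<le> measure_pmf.expectation (iid_list lam (D P)) potential"
proof -
  let ?M = "iid_list lam (D P)" and ?L = "level P"
  define B where "B = {Q. real (count_in (A ?L) Q) < \<gamma> * real lam}"
  define R where "R = real (Suc m) * H"
  have R0: "0 \<le> R" using H_nonneg by (simp add: R_def)
  have less: "real (count_in (A (Suc ?L)) P) < \<gamma> * real lam"
    using level_props(3)[OF P, of "Suc ?L"] L by force
  have lower: "real ?L * H + h (count_in (A (Suc ?L)) Q) - R * indicator B Q \<le> potential Q"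
    if Q: "Q \<in> V" for Q
  proof (cases "Q \<in> B")
    case True
    have "real ?L * H + H \<le> R"
      using mult_right_mono[of "real (Suc ?L)" "real (Suc m)" H] L H_nonneg by (simp add: R_def distrib_right)
    then have "real ?L * H + h (count_in (A (Suc ?L)) Q) - R * indicator B Q \<le> 0"
      using True h_le[of "count_in (A (Suc ?L)) Q"] by simp
    then show ?thesis using potential_bounds(1)[OF Q] by linarith
  next
    case False
    then have ge: "?L \<le> level Q" using level_props(3)[OF Q, of ?L] L by (simp add: B_def)
    have "real ?L * H + h (count_in (A (Suc ?L)) Q) \<le> potential Q"
    proof (cases "level Q = ?L")
      case True
      then show ?thesis using L by (simp add: potential_def)
    next
      case False
      then have "real (Suc ?L) * H \<le> real (level Q) * H"
        using ge H_nonneg by (intro mult_right_mono) auto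
      then show ?thesis
        unfolding potential_def using h_le[of "count_in (A (Suc ?L)) Q"]
          h_nonneg[of "if level Q < m then count_in (A (Suc (level Q))) Q else 0"]
        by (simp only: of_nat_Suc distrib_right mult_1)
    qed
    then show ?thesis using False by simp
  qed
  have int_h: "integrable (measure_pmf ?M) (\<lambda>Q. h (count_in (A (Suc ?L)) Q))"
    by (rule integrable_measure_pmf_bounded[where B = H]) (use h_nonneg h_le in auto)
  have int_B: "integrable (measure_pmf ?M) (\<lambda>Q. R * indicator B Q)"
    by (rule integrable_measure_pmf_bounded[where B = R]) (use R0 in \<open>auto split: split_indicator\<close>)
  have lost: "measure_pmf.prob ?M B \<le> exp (- (\<gamma> * real lam * \<delta>\<^sup>2 / 4))"
  proof (cases "?L = 0")
    case True
    have "count_in (A 0) Q = lam" if "Q \<in> set_pmf ?M" for Q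
    proof -
      have Q: "Q \<in> V" using that V_closed[OF P] by blast
      then have "filter (\<lambda>x. x \<in> A 0) Q = Q" using level_0[OF Q] by (auto simp: filter_id_conv)
      then show ?thesis using length_V[OF Q] by simp
    qed
    moreover have "\<gamma> * real lam \<le> real lam" using \<gamma> by (simp add: mult_left_le_one_le)
    ultimately have "set_pmf ?M \<inter> B = {}" using True by (auto simp: B_def)
    then have "measure_pmf.prob ?M B = 0" by (simp add: measure_pmf_zero_iff)
    then show ?thesis by simp
  next
    case False
    then show ?thesis
      unfolding B_def using prob_level_lost[OF P _ _ level_props(2)[OF P]] L by simp
  qed
  have "potential P + 1 - exp (- (\<gamma> * real lam * \<delta>\<^sup>2 / 4)) * R
      \<le> real ?L * H + (h (count_in (A (Suc ?L)) P) + 1) - R * measure_pmf.prob ?M B"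
    using L mult_left_mono[OF lost R0] by (simp add: potential_def mult.commute)
  also have "\<dots> \<le> real ?L * H + measure_pmf.expectation ?M (\<lambda>Q. h (count_in (A (Suc ?L)) Q))
      - R * measure_pmf.prob ?M B"
    using h_drift[OF P L level_props(2)[OF P] less] by simp
  also have "\<dots> = measure_pmf.expectation ?M
      (\<lambda>Q. real ?L * H + h (count_in (A (Suc ?L)) Q) - R * indicator B Q)"
    using int_h int_B by simp
  also have "\<dots> \<le> measure_pmf.expectation ?M potential"
  proof (rule integral_mono_AE)
    show "integrable (measure_pmf ?M) (\<lambda>Q. real ?L * H + h (count_in (A (Suc ?L)) Q) - R * indicator B Q)"
      using int_h int_B by auto
    show "integrable (measure_pmf ?M) potential"
      by (rule integrable_measure_pmf_bounded[where B = R])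
         (use potential_bounds V_closed[OF P] in \<open>force simp: R_def\<close>)
    show "AE Q in measure_pmf ?M.
        real ?L * H + h (count_in (A (Suc ?L)) Q) - R * indicator B Q \<le> potential Q"
      using lower V_closed[OF P] by (auto simp: AE_measure_pmf_iff)
  qed
  finally show ?thesis by (simp add: R_def)
qed

end

lemma expected_runtime_le_additive_drift:
  fixes G :: "bool list list \<Rightarrow> real"
  assumes init: "set_pmf (iid_list lam (uniform_bitstrings n)) \<subseteq> V"
    and closed: "\<And>P. P \<in> V \<Longrightarrow> set_pmf (ea_step f p P) \<subseteq> V"
    and bounds: "\<And>P. P \<in> V \<Longrightarrow> 0 \<le> G P" "\<And>P. P \<in> V \<Longrightarrow> G P \<le> R"
    and drift: "\<And>P. P \<in> V \<Longrightarrow> \<not> has_optimum n f P \<Longrightarrow>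
      G P + \<epsilon> \<le> measure_pmf.expectation (ea_step f p P) G"
    and \<epsilon>: "0 < \<epsilon>"
  shows "expected_runtime n f lam p \<le> ennreal (real lam * (R / \<epsilon>))"
proof -
  define \<Phi> where "\<Phi> s = (if snd s \<or> fst s \<notin> V then R else G (fst s))" for s :: "bool list list \<times> bool"
  define u where "u t = measure_pmf.prob (ea_state n f lam p t) {s. \<not> snd s}" for t
  define W where "W t = measure_pmf.expectation (ea_state n f lam p t) \<Phi>" for t
  obtain P0 where "P0 \<in> V" using init set_pmf_not_empty[of "iid_list lam (uniform_bitstrings n)"] by blast
  then have R0: "0 \<le> R" using bounds by (meson order_trans)
  have \<Phi>: "0 \<le> \<Phi> s" "\<Phi> s \<le> R" for s using bounds R0 by (auto simp: \<Phi>_def)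
  then have abs\<Phi>: "\<bar>\<Phi> s\<bar> \<le> R" for s by simp
  have supp: "fst s \<in> V \<and> (\<not> snd s \<longrightarrow> \<not> has_optimum n f (fst s))"
    if "s \<in> set_pmf (ea_state n f lam p t)" for s t
    using that
  proof (induction t arbitrary: s)
    case 0
    then show ?case using init by auto
  next
    case (Suc t)
    then obtain P b where "(P, b) \<in> set_pmf (ea_state n f lam p t)"
      and s: "s \<in> (\<lambda>Q. (Q, b \<or> has_optimum n f Q)) ` set_pmf (ea_step f p P)"
      by auto
    then have "P \<in> V" using Suc.IH by force
    then show ?case using s closed[of P] by auto
  qed
  have step: "\<Phi> s + \<epsilon> * indicator {s. \<not> snd s} s \<le> measure_pmf.expectation
      (case s of (P, b) \<Rightarrow> map_pmf (\<lambda>Q. (Q, b \<or> has_optimum n f Q)) (ea_step f p P)) \<Phi>"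
    if s: "s \<in> set_pmf (ea_state n f lam p t)" for s t
  proof (cases s)
    case (Pair P b)
    show ?thesis
    proof (cases b)
      case True
      then show ?thesis by (simp add: Pair \<Phi>_def)
    next
      case False
      have PV: "P \<in> V" and no: "\<not> has_optimum n f P" using supp[OF s] False Pair by auto
      have "G P + \<epsilon> \<le> measure_pmf.expectation (ea_step f p P) G" using drift[OF PV no] .
      also have "\<dots> \<le> measure_pmf.expectation (ea_step f p P) (\<lambda>Q. \<Phi> (Q, has_optimum n f Q))"
      proof (rule integral_mono_AE)
        show "integrable (measure_pmf (ea_step f p P)) G"
          by (rule integrable_measure_pmf_bounded[where B = R]) (use bounds closed[OF PV] in force)
        show "integrable (measure_pmf (ea_step f p P)) (\<lambda>Q. \<Phi> (Q, has_optimum n f Q))"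
          by (rule integrable_measure_pmf_bounded[where B = R]) (rule abs\<Phi>)
        show "AE Q in measure_pmf (ea_step f p P). G Q \<le> \<Phi> (Q, has_optimum n f Q)"
          using bounds closed[OF PV] by (auto simp: AE_measure_pmf_iff \<Phi>_def)
      qed
      finally show ?thesis using False PV by (simp add: Pair \<Phi>_def)
    qed
  qed
  have W_step: "W t + \<epsilon> * u t \<le> W (Suc t)" for t
  proof -
    let ?M = "ea_state n f lam p t"
    have int: "integrable (measure_pmf ?M) \<Phi>"
      by (rule integrable_measure_pmf_bounded[where B = R]) (rule abs\<Phi>)
    have int': "integrable (measure_pmf ?M) (\<lambda>s. \<epsilon> * indicator {s. \<not> snd s} s)"
      by (rule integrable_measure_pmf_bounded[where B = \<epsilon>]) (use \<epsilon> in \<open>auto split: split_indicator\<close>)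
    have "W t + \<epsilon> * u t = measure_pmf.expectation ?M (\<lambda>s. \<Phi> s + \<epsilon> * indicator {s. \<not> snd s} s)"
      using int int' by (simp add: W_def u_def)
    also have "\<dots> \<le> measure_pmf.expectation ?M (\<lambda>s. measure_pmf.expectation
      (case s of (P, b) \<Rightarrow> map_pmf (\<lambda>Q. (Q, b \<or> has_optimum n f Q)) (ea_step f p P)) \<Phi>)"
    proof (rule integral_mono_AE)
      show "integrable (measure_pmf ?M) (\<lambda>s. \<Phi> s + \<epsilon> * indicator {s. \<not> snd s} s)"
        using int int' by auto
      have E: "\<bar>measure_pmf.expectation M \<Phi>\<bar> \<le> R" for M
      proof -
        have i: "integrable (measure_pmf M) \<Phi>"
          by (rule integrable_measure_pmf_bounded[where B = R]) (rule abs\<Phi>)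
        have "0 \<le> measure_pmf.expectation M \<Phi>" using \<Phi> by (intro integral_nonneg_AE) auto
        moreover have "measure_pmf.expectation M \<Phi> \<le> R"
          using \<Phi> i by (intro measure_pmf.integral_le_const) auto
        ultimately show ?thesis by simp
      qed
      show "integrable (measure_pmf ?M) (\<lambda>s. measure_pmf.expectation
        (case s of (P, b) \<Rightarrow> map_pmf (\<lambda>Q. (Q, b \<or> has_optimum n f Q)) (ea_step f p P)) \<Phi>)"
        by (rule integrable_measure_pmf_bounded[where B = R]) (rule E)
      show "AE s in measure_pmf ?M. \<Phi> s + \<epsilon> * indicator {s. \<not> snd s} s \<le> measure_pmf.expectation
        (case s of (P, b) \<Rightarrow> map_pmf (\<lambda>Q. (Q, b \<or> has_optimum n f Q)) (ea_step f p P)) \<Phi>"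
        using step by (auto simp only: AE_measure_pmf_iff)
    qed
    also have "\<dots> = W (Suc t)"
      unfolding W_def ea_state.simps by (rule expectation_bind_pmf_bounded[symmetric]) (rule abs\<Phi>)
    finally show ?thesis .
  qed
  have partial: "\<epsilon> * (\<Sum>t<T. u t) \<le> W T" for T
  proof (induction T)
    case 0
    show ?case using \<Phi> by (auto simp: W_def intro: integral_nonneg_AE)
  next
    case (Suc T)
    then show ?case using W_step[of T] by (simp add: distrib_left)
  qed
  have W_le: "W T \<le> R" for T
    unfolding W_def using \<Phi> integrable_measure_pmf_bounded[of "ea_state n f lam p T" \<Phi> R] abs\<Phi>
    by (intro measure_pmf.integral_le_const) auto
  have sums: "(\<Sum>t<T. u t) \<le> R / \<epsilon>" for T
    using order_trans[OF partial W_le, of T] \<epsilon> by (simp add: field_simps)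
  have u0: "0 \<le> u t" for t by (simp add: u_def)
  have "(\<Sum>t. ennreal (real lam) * ennreal (u t)) \<le> ennreal (real lam * (R / \<epsilon>))"
  proof (rule suminf_le_const)
    show "summable (\<lambda>t. ennreal (real lam) * ennreal (u t))" by simp
    fix T
    have "(\<Sum>t<T. ennreal (real lam) * ennreal (u t)) = (\<Sum>t<T. ennreal (real lam * u t))"
      using u0 by (simp add: ennreal_mult)
    also have "\<dots> = ennreal (real lam * (\<Sum>t<T. u t))"
      using u0 by (simp add: sum_ennreal sum_distrib_left)
    also have "\<dots> \<le> ennreal (real lam * (R / \<epsilon>))"
      using sums by (intro ennreal_leI mult_left_mono) auto
    finally show "(\<Sum>t<T. ennreal (real lam) * ennreal (u t)) \<le> ennreal (real lam * (R / \<epsilon>))" .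
  qed
  then show ?thesis by (simp add: expected_runtime_def u_def)
qed

subsection \<open>The levels of DECOMP\<close>

lemma prob_bind_pmf_ge:
  assumes "I \<inter> J = {}"
    and I: "\<And>i. i \<in> I \<Longrightarrow> \<rho> \<le> measure_pmf.prob (N i) A"
    and J: "\<And>i. i \<in> J \<Longrightarrow> \<zeta> \<le> measure_pmf.prob (N i) A"
  shows "\<rho> * measure_pmf.prob M I + \<zeta> * measure_pmf.prob M J \<le> measure_pmf.prob (bind_pmf M N) A"
proof -
  have int: "integrable (measure_pmf M) (\<lambda>i. t * indicator S i)" for t :: real and S
    by (rule integrable_measure_pmf_bounded[where B = "\<bar>t\<bar>"]) (auto split: split_indicator)
  have "\<rho> * measure_pmf.prob M I + \<zeta> * measure_pmf.prob M J
      = measure_pmf.expectation M (\<lambda>i. \<rho> * indicator I i + \<zeta> * indicator J i)"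
    using int by simp
  also have "\<dots> \<le> measure_pmf.expectation M (\<lambda>i. measure_pmf.prob (N i) A)"
  proof (rule integral_mono)
    show "integrable (measure_pmf M) (\<lambda>i. \<rho> * indicator I i + \<zeta> * indicator J i)"
      using int by auto
    show "integrable (measure_pmf M) (\<lambda>i. measure_pmf.prob (N i) A)"
      by (rule integrable_measure_pmf_bounded[where B = 1]) auto
    show "\<rho> * indicator I i + \<zeta> * indicator J i \<le> measure_pmf.prob (N i) A" for i
      using assms by (auto simp: indicator_def)
  qed
  finally show ?thesis by (simp add: prob_bind_pmf)
qed

lemma pmf_le_prob: "x \<in> A \<Longrightarrow> pmf M x \<le> measure_pmf.prob M A"
  unfolding measure_pmf_single[symmetric] by (intro measure_pmf.finite_measure_mono) auto

locale decomp_problem =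
  fixes n N :: nat and \<sigma> :: "nat \<Rightarrow> nat set" and F :: "nat \<Rightarrow> bool list \<Rightarrow> bool"
    and a :: "nat \<Rightarrow> nat" and r :: nat
  assumes inst: "decomp_instance n N \<sigma> F a r" and n_pos: "1 \<le> n"
begin

abbreviation f :: "bool list \<Rightarrow> real" where "f \<equiv> decomp N a F"

definition s :: "nat \<Rightarrow> nat" where "s j = (\<Sum>l = 1..j. a l)"

lemma f_eq: "f x = real (\<Sum>l = 1..N. if F l x then a l else 0)"
  unfolding decomp_def of_nat_sum by (intro sum.cong) auto

lemma f_nonneg: "0 \<le> f x"
  unfolding f_eq by (rule of_nat_0_le_iff)

lemma N_pos: "1 \<le> N"
proof (rule ccontr)
  assume "\<not> 1 \<le> N"
  then have "{..<n} = {}" using inst unfolding decomp_instance_def by fastforce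
  then show False using n_pos by (simp add: lessThan_empty_iff)
qed

lemma blocks_cover: "(\<Union>l\<in>{1..N}. \<sigma> l) = {..<n}"
  using inst unfolding decomp_instance_def by blast

lemma blocks_disjoint: "l \<in> {1..N} \<Longrightarrow> l' \<in> {1..N} \<Longrightarrow> l \<noteq> l' \<Longrightarrow> \<sigma> l \<inter> \<sigma> l' = {}"
  using inst unfolding decomp_instance_def by blast

lemma block_size: "l \<in> {1..N} \<Longrightarrow> \<sigma> l \<noteq> {}" "l \<in> {1..N} \<Longrightarrow> card (\<sigma> l) \<le> r"
  using inst unfolding decomp_instance_def by blast+

lemma F_cong:
  "\<lbrakk>l \<in> {1..N}; length x = n; length y = n; \<forall>i\<in>\<sigma> l. x ! i = y ! i\<rbrakk> \<Longrightarrow> F l x = F l y"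
  using inst unfolding decomp_instance_def by blast

lemma F_satisfiable: "l \<in> {1..N} \<Longrightarrow> \<exists>x. length x = n \<and> F l x"
  using inst unfolding decomp_instance_def by blast

lemma block_subset: "l \<in> {1..N} \<Longrightarrow> \<sigma> l \<subseteq> {..<n}"
  using blocks_cover by blast

lemma finite_block: "l \<in> {1..N} \<Longrightarrow> finite (\<sigma> l)"
  using block_subset finite_subset by blast

lemma N_le: "N \<le> n"
proof -
  have "N = (\<Sum>l\<in>{1..N}. 1)" by simp
  also have "\<dots> \<le> (\<Sum>l\<in>{1..N}. card (\<sigma> l))"
  proof (rule sum_mono)
    show "1 \<le> card (\<sigma> l)" if "l \<in> {1..N}" for l
      using finite_block[OF that] block_size(1)[OF that] by (simp add: Suc_le_eq card_gt_0_iff)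
  qed
  also have "\<dots> = card (\<Union>l\<in>{1..N}. \<sigma> l)"
    using finite_block blocks_disjoint by (intro card_UN_disjoint[symmetric]) auto
  also have "\<dots> = n" by (simp only: blocks_cover card_lessThan)
  finally show ?thesis .
qed

lemma r_pos: "1 \<le> r"
proof -
  have 1: "1 \<in> {1..N}" using N_pos by simp
  then have "0 < card (\<sigma> 1)" using finite_block[OF 1] block_size(1)[OF 1] by (simp add: card_gt_0_iff)
  then show ?thesis using block_size(2)[OF 1] by linarith
qed

lemma a_antimono: "l \<le> l' \<Longrightarrow> 1 \<le> l \<Longrightarrow> l' \<le> N \<Longrightarrow> a l' \<le> a l"
proof (induction l' rule: dec_induct)
  case (step k)
  then have "a (Suc k) \<le> a k" using inst by (auto simp: decomp_instance_def)
  then show ?case using step by simp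
qed simp

lemma a_pos: "1 \<le> l \<Longrightarrow> l \<le> N \<Longrightarrow> 0 < a l"
  using a_antimono[of l N] inst by (simp add: decomp_instance_def)

lemma s_le: "j \<le> N \<Longrightarrow> s j \<le> n * a 1"
proof -
  assume j: "j \<le> N"
  have "s j \<le> j * a 1"
    unfolding s_def using sum_bounded_above[of "{1..j}" a "a 1"] a_antimono[of 1] j by auto
  also have "\<dots> \<le> n * a 1" using j N_le by (intro mult_right_mono) auto
  finally show ?thesis .
qed

lemma s_pos: "1 \<le> j \<Longrightarrow> j \<le> N \<Longrightarrow> 1 \<le> s j"
  unfolding s_def using member_le_sum[of 1 "{1..j}" a] a_pos[of 1] by simp

lemma f_gap: "real (s j) \<le> f x \<or> f x \<le> real (s j) - 1"
proof -
  have "real u \<le> real v \<or> real v \<le> real u - 1" for u v :: nat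
    by (cases "u \<le> v") auto
  then show ?thesis unfolding f_eq by blast
qed

lemma f_le: "f x \<le> real (s N)"
  unfolding f_eq s_def by (intro of_nat_mono sum_mono) auto

lemma improving_neighbour:
  assumes x: "length x = n" "real (s j) \<le> f x" "f x < real (s (Suc j))" and j: "j < N"
  obtains y where "length y = n" "card {i. i < n \<and> x ! i \<noteq> y ! i} \<le> r" "real (s (Suc j)) \<le> f y"
proof -
  have "\<exists>l\<in>{1..Suc j}. \<not> F l x"
  proof (rule ccontr)
    assume "\<not> ?thesis"
    then have "s (Suc j) = (\<Sum>l = 1..Suc j. if F l x then a l else 0)"
      unfolding s_def by (intro sum.cong) auto
    also have "\<dots> \<le> (\<Sum>l = 1..N. if F l x then a l else 0)"
      using j by (intro sum_mono2) auto
    finally have "real (s (Suc j)) \<le> f x" unfolding f_eq by (rule of_nat_mono)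
    then show False using x(3) by simp
  qed
  then obtain l where l: "1 \<le> l" "l \<le> Suc j" "\<not> F l x" by auto
  then have lN: "l \<in> {1..N}" using j by simp
  then obtain w where w: "length w = n" "F l w" using F_satisfiable by blast
  define y where "y = map (\<lambda>i. if i \<in> \<sigma> l then w ! i else x ! i) [0..<n]"
  have ly: "length y = n" by (simp add: y_def)
  have y_nth: "y ! i = (if i \<in> \<sigma> l then w ! i else x ! i)" if "i < n" for i
    using that by (simp add: y_def)
  have "F l y = F l w" using block_subset[OF lN] by (intro F_cong lN ly w) (auto simp: y_nth)
  then have Fl: "F l y" using w by simp
  have Fl': "F l' y = F l' x" if "l' \<in> {1..N}" "l' \<noteq> l" for l'
  proof -
    have "\<sigma> l \<inter> \<sigma> l' = {}" using blocks_disjoint that lN by metis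
    have "y ! i = x ! i" if "i \<in> \<sigma> l'" for i
    proof -
      have "i < n" "i \<notin> \<sigma> l"
        using block_subset[OF \<open>l' \<in> {1..N}\<close>] that \<open>\<sigma> l \<inter> \<sigma> l' = {}\<close> by auto
      then show ?thesis by (simp add: y_nth)
    qed
    then show ?thesis by (intro F_cong that ly x) auto
  qed
  have split: "(\<Sum>l' = 1..N. g l') = g l + (\<Sum>l'\<in>{1..N} - {l}. g l')" for g :: "nat \<Rightarrow> nat"
    using lN by (intro sum.remove) auto
  have "(\<Sum>l'\<in>{1..N} - {l}. if F l' y then a l' else 0) = (\<Sum>l'\<in>{1..N} - {l}. if F l' x then a l' else 0)"
    using Fl' by (intro sum.cong) auto
  then have "f y = f x + real (a l)" unfolding f_eq split using l(3) Fl by simp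
  moreover have "a (Suc j) \<le> a l" using l j by (intro a_antimono) auto
  moreover have "s (Suc j) = s j + a (Suc j)" by (simp add: s_def)
  ultimately have "real (s (Suc j)) \<le> f y" using x(2) by simp
  moreover have "card {i. i < n \<and> x ! i \<noteq> y ! i} \<le> r"
  proof -
    have "card {i. i < n \<and> x ! i \<noteq> y ! i} \<le> card (\<sigma> l)"
      using finite_block[OF lN] by (intro card_mono) (auto simp: y_nth split: if_splits)
    also have "\<dots> \<le> r" using block_size(2)[OF lN] .
    finally show ?thesis .
  qed
  ultimately show ?thesis using that ly by blast
qed

end

lemma selection_growth_bound:
  fixes c M \<rho> \<sigma> L X :: real
  assumes c: "0 < c" "c < 1" and M: "0 < M" and \<sigma>: "1 \<le> \<sigma>" "\<sigma> \<le> M" and \<rho>: "1 - (1 - c) / M \<le> \<rho>" "0 \<le> \<rho>"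
    and L: "0 < L" and X: "0 \<le> X"
  shows "(1 + c / (2 * M)) * min X (c / 2 * L) \<le> L * (\<rho> * (X * \<sigma> / (X + L * (\<sigma> - 1))))"
proof -
  define Y where "Y = min X (c / 2 * L)"
  have Y0: "0 \<le> Y" "Y \<le> X" "Y \<le> c / 2 * L" using c L X by (auto simp: Y_def)
  show ?thesis
  proof (cases "Y = 0")
    case True
    then have "(1 + c / (2 * M)) * min X (c / 2 * L) = 0" by (simp add: Y_def)
    also have "\<dots> \<le> L * (\<rho> * (X * \<sigma> / (X + L * (\<sigma> - 1))))"
      using L X \<sigma> \<rho> by (intro mult_nonneg_nonneg divide_nonneg_nonneg add_nonneg_nonneg) auto
    finally show ?thesis .
  next
    case False
    then have Yp: "0 < Y" using Y0 by simp
    have den: "0 < Y + L * (\<sigma> - 1)" "0 < X + L * (\<sigma> - 1)" using Yp Y0 L \<sigma> by (auto intro: add_pos_nonneg)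
    define \<tau> where "\<tau> = \<sigma> / M"
    have \<tau>: "0 < \<tau>" "\<tau> \<le> 1" using \<sigma> M by (auto simp: \<tau>_def)
    have "(1 + c / (2 * M)) * (c / 2 + \<sigma> - 1) \<le> (c / 2 + \<sigma> - 1) + c / (2 * M) * \<sigma>"
    proof -
      have "c / (2 * M) * (c / 2 + \<sigma> - 1) \<le> c / (2 * M) * \<sigma>"
        using c M by (intro mult_left_mono) auto
      then show ?thesis by (simp only: distrib_right mult_1)
    qed
    also have "\<dots> = \<sigma> - (1 - c / 2) + c / 2 * \<tau>" by (simp add: \<tau>_def)
    also have "\<dots> \<le> \<sigma> - (1 - c) * \<tau>"
      using mult_left_mono[OF \<tau>(2), of "1 - c / 2"] c by (simp add: algebra_simps)
    also have "\<dots> = (1 - (1 - c) / M) * \<sigma>" by (simp add: \<tau>_def algebra_simps)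
    also have "\<dots> \<le> \<rho> * \<sigma>" using \<rho> \<sigma> by (intro mult_right_mono) auto
    finally have key: "(1 + c / (2 * M)) * (c / 2 + \<sigma> - 1) \<le> \<rho> * \<sigma>" .
    have "(1 + c / (2 * M)) * (Y + L * (\<sigma> - 1)) \<le> (1 + c / (2 * M)) * (L * (c / 2 + \<sigma> - 1))"
      using c M Y0 by (intro mult_left_mono) (auto simp: algebra_simps)
    also have "\<dots> = L * ((1 + c / (2 * M)) * (c / 2 + \<sigma> - 1))" by simp
    also have "\<dots> \<le> L * (\<rho> * \<sigma>)" using key L by (intro mult_left_mono) auto
    finally have "(1 + c / (2 * M)) * (Y + L * (\<sigma> - 1)) * Y \<le> L * (\<rho> * \<sigma>) * Y"
      using Y0 by (intro mult_right_mono) auto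
    then have "(1 + c / (2 * M)) * Y \<le> L * (\<rho> * (Y * \<sigma> / (Y + L * (\<sigma> - 1))))"
      using den by (simp add: le_divide_eq ac_simps)
    also have "\<dots> \<le> L * (\<rho> * (X * \<sigma> / (X + L * (\<sigma> - 1))))"
    proof (intro mult_left_mono)
      have "Y * (L * (\<sigma> - 1)) \<le> X * (L * (\<sigma> - 1))" using Y0 L \<sigma> by (intro mult_right_mono) auto
      then have "Y * (X + L * (\<sigma> - 1)) \<le> X * (Y + L * (\<sigma> - 1))" by (simp add: distrib_left mult.commute)
      then have "Y / (Y + L * (\<sigma> - 1)) \<le> X / (X + L * (\<sigma> - 1))"
        using den by (simp add: divide_le_eq le_divide_eq mult.commute)
      then have "Y / (Y + L * (\<sigma> - 1)) * \<sigma> \<le> X / (X + L * (\<sigma> - 1)) * \<sigma>"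
        using \<sigma> by (intro mult_right_mono) auto
      then show "Y * \<sigma> / (Y + L * (\<sigma> - 1)) \<le> X * \<sigma> / (X + L * (\<sigma> - 1))" by simp
    qed (use L \<rho> in auto)
    finally show ?thesis by (simp add: Y_def)
  qed
qed

locale decomp_ea = decomp_problem +
  fixes c :: real and lam :: nat
  assumes c: "0 < c" "c < 1" and n_ge: "3 \<le> n"
    and lam_ge: "32 * (real n * real (a 1)) \<le> c\<^sup>2 * real lam"
begin

definition M :: real where "M = real n * real (a 1)"
definition p :: real where "p = ((1 - c) / M) / real n"
definition z :: real where "z = c * p ^ r * (c / 4)"
definition V :: "bool list list set" where
  "V = {P. length P = lam \<and> (\<forall>x\<in>set P. length x = n)}"
definition levels :: "nat \<Rightarrow> bool list set" where "levels j = {x. real (s j) \<le> f x}"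
definition offspring :: "bool list list \<Rightarrow> bool list pmf" where
  "offspring P = bind_pmf (fp_select f P) (\<lambda>i. mutate p (P ! i))"

lemma M_ge: "real n \<le> M" "3 \<le> M"
proof -
  have "1 \<le> real (a 1)" using a_pos[of 1] N_pos by simp
  then show "real n \<le> M" using mult_left_mono[of 1 "real (a 1)" "real n"] by (simp add: M_def)
  then show "3 \<le> M" using n_ge by simp
qed

lemma p_bounds: "0 < p" "p \<le> 1 / 8"
proof -
  show "0 < p" using c M_ge n_ge by (simp add: p_def)
  have "(1 - c) / M \<le> 1 / M" using c M_ge by (intro divide_right_mono) auto
  also have "1 / M \<le> 1 / 3" using M_ge by (intro divide_left_mono) auto
  finally have "p \<le> (1 / 3) / real n" unfolding p_def using n_ge by (intro divide_right_mono) auto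
  also have "\<dots> \<le> (1 / 3) / 3" using n_ge by (intro divide_left_mono) auto
  finally show "p \<le> 1 / 8" by simp
qed

lemma no_flip_prob: "1 - (1 - c) / M \<le> (1 - p) ^ n" "1 / 2 \<le> (1 - p) ^ n" "c \<le> (1 - p) ^ n"
proof -
  have "1 + real n * (- p) \<le> (1 + (- p)) ^ n" using p_bounds by (intro Bernoulli_inequality) auto
  moreover have "real n * p = (1 - c) / M" using n_ge by (simp add: p_def)
  ultimately show 1: "1 - (1 - c) / M \<le> (1 - p) ^ n" by simp
  have "(1 - c) / M \<le> (1 - c) / 2" using c M_ge by (intro divide_left_mono) auto
  then have "1 - (1 - c) / 2 \<le> (1 - p) ^ n" by (rule order_trans[OF diff_left_mono 1])
  moreover have "1 / 2 \<le> q \<and> c \<le> q" if "1 - (1 - c) / 2 \<le> q" for q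
    using that c by (simp add: field_simps)
  ultimately show "1 / 2 \<le> (1 - p) ^ n" "c \<le> (1 - p) ^ n" by blast+
qed

lemma population_pos: "0 < real lam"
  using lam_ge M_ge n_ge by (cases "lam = 0") (auto simp: M_def)

lemma offspring_length:
  assumes "P \<in> V" "y \<in> set_pmf (offspring P)"
  shows "length y = n"
proof -
  obtain i where i: "i \<in> set_pmf (fp_select f P)" "y \<in> set_pmf (mutate p (P ! i))"
    using assms(2) by (auto simp: offspring_def)
  have "P \<noteq> []" using assms(1) population_pos by (auto simp: V_def)
  then have "i < length P" using set_fp_select[of f, OF f_nonneg _ i(1)] by simp
  then show ?thesis using assms(1) length_mutate[OF i(2)] by (auto simp: V_def)
qed

lemma prob_mutate_stay:
  assumes "length x = n" "x \<in> levels j"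
  shows "(1 - p) ^ n \<le> measure_pmf.prob (mutate p x) (levels j)"
  using pmf_mutate_ge[of p x x] p_bounds assms pmf_le_prob[of x "levels j" "mutate p x"] by simp

lemma prob_mutate_improve:
  assumes "length x = n" "x \<in> levels j" "x \<notin> levels (Suc j)" "j < N"
  shows "c * p ^ r \<le> measure_pmf.prob (mutate p x) (levels (Suc j))"
proof -
  obtain y where y: "length y = n" "card {i. i < n \<and> x ! i \<noteq> y ! i} \<le> r" "real (s (Suc j)) \<le> f y"
    using improving_neighbour[of x j] assms by (auto simp: levels_def)
  have "c * p ^ r \<le> (1 - p) ^ n * p ^ card {i. i < n \<and> x ! i \<noteq> y ! i}"
    using p_bounds no_flip_prob y(2) c by (intro mult_mono power_decreasing) auto
  also have "\<dots> \<le> pmf (mutate p x) y"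
    using pmf_mutate_ge[of p y x] p_bounds assms y by (simp add: mult.commute)
  also have "\<dots> \<le> measure_pmf.prob (mutate p x) (levels (Suc j))"
    using y by (intro pmf_le_prob) (simp add: levels_def)
  finally show ?thesis .
qed

lemma select_prob_ge:
  assumes "1 \<le> j" "P \<in> V"
  shows "j \<le> N \<Longrightarrow> real (count_in (levels j) P) * real (s j)
        / (real (count_in (levels j) P) + real lam * (real (s j) - 1))
      \<le> measure_pmf.prob (fp_select f P) {i. i < lam \<and> P ! i \<in> levels j}"
  using prob_fp_select_ge[of f P "real (s j)", OF f_nonneg f_gap _ refl] s_pos[OF assms(1)] assms(2)
  by (simp add: V_def levels_def)

lemma select_growth:
  assumes "P \<in> V" "1 \<le> j" "j \<le> N"
  shows "(1 + c / (2 * M)) * min (real (count_in (levels j) P)) (c / 2 * real lam)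
      \<le> real lam * ((1 - p) ^ n * measure_pmf.prob (fp_select f P) {i. i < lam \<and> P ! i \<in> levels j})"
proof -
  have "(1 + c / (2 * M)) * min (real (count_in (levels j) P)) (c / 2 * real lam)
      \<le> real lam * ((1 - p) ^ n * (real (count_in (levels j) P) * real (s j)
        / (real (count_in (levels j) P) + real lam * (real (s j) - 1))))"
  proof (rule selection_growth_bound)
    have "s j \<le> n * a 1" using s_le assms by simp
    then have "real (s j) \<le> real (n * a 1)" by (rule of_nat_mono)
    then show "real (s j) \<le> M" by (simp add: M_def)
  qed (use c M_ge s_pos[OF assms(2,3)] no_flip_prob p_bounds population_pos in auto)
  also have "\<dots> \<le> real lam * ((1 - p) ^ n * measure_pmf.prob (fp_select f P) {i. i < lam \<and> P ! i \<in> levels j})"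
    using select_prob_ge[OF assms(2,1,3)] p_bounds population_pos by (intro mult_left_mono) auto
  finally show ?thesis .
qed

lemma select_prob_ge_fraction:
  assumes "P \<in> V" "j \<le> N"
  shows "real (count_in (levels j) P) / real lam
      \<le> measure_pmf.prob (fp_select f P) {i. i < lam \<and> P ! i \<in> levels j}"
proof -
  let ?X = "real (count_in (levels j) P)"
  have X: "?X \<le> real lam" using assms by (auto simp: V_def length_filter_le)
  show ?thesis
  proof (cases "j = 0")
    case True
    have "P \<noteq> []" using assms(1) population_pos by (auto simp: V_def)
    then have "set_pmf (fp_select f P) \<subseteq> {i. i < lam \<and> P ! i \<in> levels j}"
      using set_fp_select[of f P] assms(1) f_nonneg True by (auto simp: V_def levels_def s_def)
    then have "measure_pmf.prob (fp_select f P) {i. i < lam \<and> P ! i \<in> levels j} = 1"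
      by (simp add: measure_pmf.prob_eq_1 AE_measure_pmf_iff subset_iff)
    then show ?thesis using X population_pos by simp
  next
    case False
    then have j: "1 \<le> j" by simp
    have s1: "1 \<le> real (s j)" using s_pos[OF j assms(2)] by simp
    have "?X / real lam \<le> ?X * real (s j) / (?X + real lam * (real (s j) - 1))"
    proof (cases "?X = 0")
      case False
      then have den: "0 < ?X + real lam * (real (s j) - 1)" using s1 by (intro add_pos_nonneg) auto
      have "?X * (?X + real lam * (real (s j) - 1)) \<le> ?X * (real (s j) * real lam)"
        using X by (intro mult_left_mono) (auto simp: algebra_simps)
      then show ?thesis using den population_pos by (simp add: divide_le_eq le_divide_eq ac_simps)
    qed simp
    also have "\<dots> \<le> measure_pmf.prob (fp_select f P) {i. i < lam \<and> P ! i \<in> levels j}"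
      using select_prob_ge[OF j assms] .
    finally show ?thesis .
  qed
qed

lemma z_bounds: "0 < z" "z \<le> c / 32"
proof -
  show "0 < z" using p_bounds c by (simp add: z_def)
  have "p ^ r \<le> p ^ 1" using p_bounds r_pos by (intro power_decreasing) auto
  then have "c * p ^ r \<le> 1 * (1 / 8)" using c p_bounds by (intro mult_mono) auto
  then have "c * p ^ r * (c / 4) \<le> 1 / 8 * (c / 4)" using c by (intro mult_right_mono) auto
  then show "z \<le> c / 32" by (simp add: z_def)
qed

lemma offspring_growth:
  assumes "P \<in> V" "1 \<le> j" "j \<le> N"
  shows "(1 + c / (2 * M)) * min (real (count_in (levels j) P)) (c / 2 * real lam)
      \<le> real lam * measure_pmf.prob (offspring P) (levels j)"
proof -
  let ?I = "{i. i < lam \<and> P ! i \<in> levels j}"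
  have "(1 - p) ^ n * measure_pmf.prob (fp_select f P) ?I + 0 * measure_pmf.prob (fp_select f P) {}
      \<le> measure_pmf.prob (offspring P) (levels j)"
    unfolding offspring_def using assms(1)
    by (intro prob_bind_pmf_ge) (auto intro!: prob_mutate_stay simp: V_def)
  then have "real lam * ((1 - p) ^ n * measure_pmf.prob (fp_select f P) ?I)
      \<le> real lam * measure_pmf.prob (offspring P) (levels j)"
    by (intro mult_left_mono) auto
  then show ?thesis using select_growth[OF assms] by linarith
qed

text \<open>If selection favours level \<open>Suc j\<close> with probability at least \<open>c / 4\<close>, copies alone
  suffice; otherwise level \<open>j\<close> proper is selected with probability at least \<open>c / 4\<close>.\<close>

lemma offspring_upgrade:
  assumes P: "P \<in> V" and j: "j < N" and full: "c / 2 * real lam \<le> real (count_in (levels j) P)"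
    and less: "real (count_in (levels (Suc j)) P) \<le> c / 2 * real lam / 8"
  shows "(1 + c / (2 * M)) * real (count_in (levels (Suc j)) P) + real lam * z
      \<le> real lam * measure_pmf.prob (offspring P) (levels (Suc j))"
proof -
  let ?X = "real (count_in (levels (Suc j)) P)" and ?sel = "fp_select f P"
  define I where "I = {i. i < lam \<and> P ! i \<in> levels (Suc j)}"
  define J where "J = {i. i < lam \<and> P ! i \<in> levels j} - I"
  define Q where "Q = measure_pmf.prob ?sel I"
  have "levels (Suc j) \<subseteq> levels j" by (auto simp: levels_def s_def)
  then have IJ: "{i. i < lam \<and> P ! i \<in> levels j} = I \<union> J" "I \<inter> J = {}"
    by (auto simp: I_def J_def)
  have "c / 2 \<le> real (count_in (levels j) P) / real lam"
    using full population_pos by (simp add: field_simps)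
  also have "\<dots> \<le> measure_pmf.prob ?sel (I \<union> J)"
    using select_prob_ge_fraction[OF P, of j] j IJ by simp
  also have "\<dots> = Q + measure_pmf.prob ?sel J"
    unfolding Q_def using IJ(2) by (intro measure_pmf.finite_measure_Union) auto
  finally have QJ: "c / 2 \<le> Q + measure_pmf.prob ?sel J" .
  have pr: "(1 - p) ^ n * Q + c * p ^ r * measure_pmf.prob ?sel J
      \<le> measure_pmf.prob (offspring P) (levels (Suc j))"
    unfolding offspring_def Q_def using P j
    by (intro prob_bind_pmf_ge IJ)
       (auto intro!: prob_mutate_stay prob_mutate_improve simp: V_def I_def J_def)
  have grow: "(1 + c / (2 * M)) * ?X \<le> real lam * ((1 - p) ^ n * Q)"
    using select_growth[OF P, of "Suc j"] j less c population_pos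
    by (simp add: min_def Q_def I_def split: if_splits)
  show ?thesis
  proof (cases "Q \<le> c / 4")
    case True
    then have "c * p ^ r * (c / 4) \<le> c * p ^ r * measure_pmf.prob ?sel J"
      using QJ c p_bounds by (intro mult_left_mono) auto
    then have "(1 - p) ^ n * Q + z \<le> measure_pmf.prob (offspring P) (levels (Suc j))"
      using pr by (simp add: z_def)
    from mult_left_mono[OF this, of "real lam"] show ?thesis using grow by (simp add: distrib_left)
  next
    case False
    have "0 \<le> c * p ^ r * measure_pmf.prob ?sel J" using c p_bounds by auto
    moreover have "1 / 2 * (c / 4) \<le> (1 - p) ^ n * Q"
      using False no_flip_prob c p_bounds by (intro mult_mono) auto
    ultimately have "c / 8 \<le> measure_pmf.prob (offspring P) (levels (Suc j))" using pr by linarith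
    from mult_left_mono[OF this, of "real lam"]
    have 1: "real lam * (c / 8) \<le> real lam * measure_pmf.prob (offspring P) (levels (Suc j))" by simp
    have "c / (2 * M) \<le> 1 / 6" using c M_ge by (simp add: field_simps)
    then have "(1 + c / (2 * M)) * ?X \<le> (1 + 1 / 6) * (c / 2 * real lam / 8)"
      using less c M_ge by (intro mult_mono) auto
    moreover have "real lam * z \<le> real lam * (c / 32)" using z_bounds by (intro mult_left_mono) auto
    moreover have "(1 + 1 / 6) * (c / 2 * real lam / 8) + real lam * (c / 32) \<le> real lam * (c / 8)"
      using c population_pos mult_pos_pos[OF c(1) population_pos] by (simp add: algebra_simps)
    ultimately show ?thesis using 1 by linarith
  qed
qed

lemma level_process:
  assumes "lam \<le> 2 ^ K"
  shows "level_process offspring V levels lam N K (c / 2) (c / (2 * M)) z"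
proof
  show "length P = lam" if "P \<in> V" for P using that by (simp add: V_def)
  show "set P \<subseteq> levels 0" for P using f_nonneg by (auto simp: levels_def s_def)
  show "set_pmf (iid_list lam (offspring P)) \<subseteq> V" if "P \<in> V" for P
    using set_pmf_iid_list offspring_length[OF that] by (fastforce simp: V_def)
  show "0 < c / (2 * M)" "c / (2 * M) \<le> 1" using c M_ge by (auto simp: field_simps)
  show "8 \<le> c / 2 * (c / (2 * M)) * real lam"
    using lam_ge M_ge unfolding M_def[symmetric] by (simp add: field_simps power2_eq_square)
qed (use c z_bounds assms offspring_growth offspring_upgrade in auto)

lemma ea_step_eq: "P \<in> V \<Longrightarrow> ea_step f p P = iid_list lam (offspring P)"
  by (simp add: ea_step_def offspring_def V_def)

lemma expected_runtime_le:
  assumes K: "lam \<le> 2 ^ K"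
    and R: "R = real (Suc N) * (16 * exp 1 * M / c * real (Suc K)
              + exp 1 * (1 + 32 * M / (c ^ 3 * real lam * p ^ r)))"
    and small: "exp (- (c ^ 3 * real lam / (32 * M\<^sup>2))) * R \<le> 1 / 2"
  shows "expected_runtime n f lam p \<le> ennreal (real lam * (2 * R))"
proof -
  interpret level_process offspring V levels lam N K "c / 2" "c / (2 * M)" z
    using K by (rule level_process)
  have "4 / (real lam * z * (c / (2 * M))) = 32 * M / (c ^ 3 * real lam * p ^ r)"
    unfolding z_def power3_eq_cube by simp
  then have RH: "R = real (Suc N) * H" unfolding R H_def by simp
  have ex: "c / 2 * real lam * (c / (2 * M))\<^sup>2 / 4 = c ^ 3 * real lam / (32 * M\<^sup>2)"
    by (simp add: power2_eq_square power3_eq_cube)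
  have "expected_runtime n f lam p \<le> ennreal (real lam * (R / (1 / 2)))"
  proof (rule expected_runtime_le_additive_drift[where V = V and G = potential])
    have "{xs :: bool list. length xs = n} \<noteq> {}" "finite {xs :: bool list. length xs = n}"
      using finite_lists_length_eq[of "UNIV :: bool set" n] Ex_list_of_length[of n] by auto
    then have "xs \<in> set_pmf (uniform_bitstrings n) \<Longrightarrow> length xs = n" for xs
      by (simp add: uniform_bitstrings_def set_pmf_of_set)
    then show "set_pmf (iid_list lam (uniform_bitstrings n)) \<subseteq> V"
      using set_pmf_iid_list by (fastforce simp: V_def)
    show "set_pmf (ea_step f p P) \<subseteq> V" if "P \<in> V" for P
      using V_closed[OF that] by (simp add: ea_step_eq that)
    show "0 \<le> potential P" "potential P \<le> R" if "P \<in> V" for P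
      using potential_bounds[OF that] by (simp_all add: RH)
    show "potential P + 1 / 2 \<le> measure_pmf.expectation (ea_step f p P) potential"
      if P: "P \<in> V" and no: "\<not> has_optimum n f P" for P
    proof -
      have "level P < N"
      proof (rule ccontr)
        assume "\<not> level P < N"
        then have "level P = N" using level_props(1)[OF P] by simp
        then have "0 < count_in (levels N) P"
          using level_props(2)[OF P] c population_pos mult_pos_pos[OF c(1) population_pos] by (cases "count_in (levels N) P") auto
        then obtain x where x: "x \<in> set P" "x \<in> levels N" by (auto simp: filter_empty_conv)
        then have "is_optimum n f x"
          using P f_le unfolding is_optimum_def levels_def V_def by (auto intro: order_trans)
        then show False using no x by (auto simp: has_optimum_def)
      qed
      then show ?thesis
        using potential_drift[OF P] small unfolding ex RH by (simp add: ea_step_eq P)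
    qed
  qed simp
  then show ?thesis by (simp add: mult.commute)
qed

end

subsection \<open>The runtime bound\<close>

context decomp_ea
begin

lemma expected_runtime_le_explicit:
  assumes lam_large: "192 / c ^ 3 * M\<^sup>2 * real r * ln M \<le> real lam"
    and C: "log 2 (real lam) + 2 \<le> C * ln M"
    and B: "B = 2 * exp 1 * (16 * C / c + 1 + 32 / c ^ 3)"
    and n_large: "4 * B \<le> real n" "1 / (1 - c) \<le> real n"
  shows "expected_runtime n f lam p
       \<le> ennreal (2 * B * (real n * M * real lam * ln M + real n * M / p ^ r))"
proof -
  define K where "K = nat \<lceil>log 2 (real lam)\<rceil>"
  define R where "R = real (Suc N) * (16 * exp 1 * M / c * real (Suc K)
              + exp 1 * (1 + 32 * M / (c ^ 3 * real lam * p ^ r)))"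
  have M3: "3 \<le> M" using M_ge by simp
  have lnM: "1 \<le> ln M"
  proof -
    have "exp 1 \<le> M" using exp_le M3 by linarith
    then show ?thesis using M3 by (subst ln_ge_iff) auto
  qed
  have lam1: "1 \<le> real lam" using population_pos by simp
  have log0: "0 \<le> log 2 (real lam)" using lam1 by simp
  have "0 < C * ln M" using C log0 by linarith
  then have C0: "0 \<le> C" using lnM by (simp add: zero_less_mult_iff)
  have B0: "0 \<le> B" using C0 c by (simp add: B)
  have pr: "0 < p ^ r" using p_bounds by simp
  have K1: "lam \<le> 2 ^ K"
  proof -
    have "real lam = 2 powr (log 2 (real lam))" using population_pos by simp
    also have "\<dots> \<le> 2 powr real K" unfolding K_def using log0 by (intro powr_mono) auto
    also have "\<dots> = real (2 ^ K)" by (simp add: powr_realpow)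
    finally show ?thesis by (simp only: of_nat_le_iff)
  qed
  have K2: "real (Suc K) \<le> C * ln M"
  proof -
    have "real K \<le> log 2 (real lam) + 1" unfolding K_def using log0 by linarith
    then show ?thesis using C by simp
  qed
  have R0: "0 \<le> R" unfolding R_def using c M3 population_pos pr
    by (intro mult_nonneg_nonneg add_nonneg_nonneg divide_nonneg_nonneg) auto
  have R_le: "R \<le> B * (real n * M * (ln M + 1 / (real lam * p ^ r)))"
  proof -
    have N2: "real (Suc N) \<le> 2 * real n" using N_le n_ge by simp
    have 1: "16 * exp 1 * M / c * real (Suc K) \<le> 16 * exp 1 * M / c * (C * ln M)"
      using K2 c M3 by (intro mult_left_mono) auto
    have "1 * 1 \<le> M * ln M" using M3 lnM by (intro mult_mono) auto
    then have 2: "exp 1 * (1 + 32 * M / (c ^ 3 * real lam * p ^ r))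
        \<le> exp 1 * (M * ln M + 32 / c ^ 3 * M * (1 / (real lam * p ^ r)))"
      by (intro mult_left_mono) auto
    define u where "u = 1 / (real lam * p ^ r)"
    have u0: "0 \<le> u" using pr by (simp add: u_def)
    have "R \<le> 2 * real n * (16 * exp 1 * M / c * (C * ln M)
        + exp 1 * (M * ln M + 32 / c ^ 3 * M * u))"
      unfolding R_def u_def
    proof (rule mult_mono)
      show "0 \<le> 16 * exp 1 * M / c * real (Suc K) + exp 1 * (1 + 32 * M / (c ^ 3 * real lam * p ^ r))"
        using c M3 population_pos pr
        by (intro mult_nonneg_nonneg add_nonneg_nonneg divide_nonneg_nonneg) auto
    qed (use N2 add_mono[OF 1 2] in auto)
    also have "\<dots> = 2 * exp 1 * real n * M * ((16 * C / c + 1) * ln M + 32 / c ^ 3 * u)"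
      by (simp add: algebra_simps)
    also have "\<dots> \<le> 2 * exp 1 * real n * M * ((16 * C / c + 1 + 32 / c ^ 3) * (ln M + u))"
    proof (rule mult_left_mono)
      have "0 \<le> 32 / c ^ 3 * ln M" "0 \<le> (16 * C / c + 1) * u"
        using c lnM C0 u0 by auto
      then show "(16 * C / c + 1) * ln M + 32 / c ^ 3 * u \<le> (16 * C / c + 1 + 32 / c ^ 3) * (ln M + u)"
        unfolding distrib_left distrib_right[of "16 * C / c + 1"] by linarith
    qed (use M3 in auto)
    also have "\<dots> = B * (real n * M * (ln M + u))" by (simp add: B)
    finally show ?thesis by (simp add: u_def)
  qed
  have small: "exp (- (c ^ 3 * real lam / (32 * M\<^sup>2))) * R \<le> 1 / 2"
  proof -
    have inv_p: "1 / p \<le> M ^ 3"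
    proof -
      have "1 / p = real n * M * (1 / (1 - c))" using n_ge M3 c by (simp add: p_def)
      also have "\<dots> \<le> real n * M * real n" using n_large M3 by (intro mult_left_mono) auto
      also have "\<dots> \<le> M * M * M" using M_ge M3 by (intro mult_mono) auto
      finally show ?thesis by (simp add: power3_eq_cube)
    qed
    have "1 / (real lam * p ^ r) \<le> 1 / (1 * p ^ r)"
      using lam1 pr by (intro divide_left_mono mult_right_mono) auto
    also have "\<dots> = (1 / p) ^ r" by (simp add: power_one_over)
    also have "\<dots> \<le> (M ^ 3) ^ r" using inv_p p_bounds by (intro power_mono) auto
    also have "\<dots> = M ^ (3 * r)" by (simp add: power_mult)
    finally have u: "1 / (real lam * p ^ r) \<le> M ^ (3 * r)" .
    have "ln M \<le> M - 1" using M3 by (intro ln_le_minus_one) auto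
    also have "\<dots> \<le> M ^ 1" by simp
    also have "\<dots> \<le> M ^ (3 * r)" using M3 r_pos by (intro power_increasing) auto
    finally have l: "ln M \<le> M ^ (3 * r)" .
    have "R \<le> B * (M * M * (M ^ (3 * r) + M ^ (3 * r)))"
    proof (rule order_trans[OF R_le], intro mult_left_mono)
      have "0 \<le> 1 / (real lam * p ^ r)" using pr by simp
      then show "real n * M * (ln M + 1 / (real lam * p ^ r)) \<le> M * M * (M ^ (3 * r) + M ^ (3 * r))"
        using u l lnM M_ge M3 by (intro mult_mono add_mono) auto
    qed (rule B0)
    also have "\<dots> = 2 * B * (M ^ 2 * M ^ (3 * r))" by (simp add: power2_eq_square)
    also have "\<dots> \<le> 2 * B * (M ^ (2 * r) * M ^ (3 * r))"
      using B0 M3 r_pos by (intro mult_left_mono mult_right_mono power_increasing) auto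
    also have "\<dots> = 2 * B * M ^ (5 * r)" by (simp flip: power_add)
    finally have R5: "R \<le> 2 * B * M ^ (5 * r)" .
    have "6 * real r * ln M \<le> c ^ 3 * real lam / (32 * M\<^sup>2)"
      using lam_large c M3 by (simp add: field_simps)
    then have "exp (- (c ^ 3 * real lam / (32 * M\<^sup>2))) \<le> exp (- (real (6 * r) * ln M))" by simp
    also have "\<dots> = 1 / M ^ (6 * r)"
      using M3 unfolding exp_minus exp_of_nat_mult by (simp add: divide_inverse)
    finally have "exp (- (c ^ 3 * real lam / (32 * M\<^sup>2))) * R \<le> 1 / M ^ (6 * r) * (2 * B * M ^ (5 * r))"
      using R5 R0 M3 by (intro mult_mono) auto
    also have "\<dots> = 2 * B / M ^ r"
    proof -
      have "M ^ (6 * r) = M ^ r * M ^ (5 * r)" by (simp flip: power_add)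
      then show ?thesis using M3 by simp
    qed
    also have "\<dots> \<le> 2 * B / M"
      using B0 M3 r_pos power_increasing[of 1 r M] by (intro divide_left_mono) auto
    also have "\<dots> \<le> 1 / 2" using n_large M_ge M3 by (simp add: field_simps)
    finally show ?thesis .
  qed
  have "real lam * (2 * R) \<le> real lam * (2 * (B * (real n * M * (ln M + 1 / (real lam * p ^ r)))))"
    using R_le by (intro mult_left_mono) auto
  also have "\<dots> = 2 * B * (real n * M * real lam * ln M + real n * M / p ^ r)"
    using population_pos by (simp add: field_simps)
  finally show ?thesis
    using expected_runtime_le[OF K1 R_def small] by (meson ennreal_leI order_trans)
qed

end

theorem theorem8:
  fixes c :: real
  assumes "0 < c" and "c < 1"
  shows "\<forall>K::real. K > 0 \<longrightarrow> (\<exists>c'::real. c' > 0 \<and>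
    (\<forall>(N :: nat \<Rightarrow> nat) (\<sigma> :: nat \<Rightarrow> nat \<Rightarrow> nat set) (F :: nat \<Rightarrow> nat \<Rightarrow> bool list \<Rightarrow> bool)
       (a :: nat \<Rightarrow> nat \<Rightarrow> nat) (r :: nat \<Rightarrow> nat) (lam :: nat \<Rightarrow> nat).
      (\<forall>n\<ge>1. decomp_instance n (N n) (\<sigma> n) (F n) (a n) (r n)) \<and>
      (\<forall>n\<ge>1. real (lam n) \<ge> c' * real n ^ 2 * real (a n 1) ^ 2 * real (r n) * ln (real n * real (a n 1))) \<and>
      (\<exists>C. \<forall>n\<ge>1. real (lam n) \<le> C * (real n * real (a n 1)) powr K)
      \<longrightarrow>
      (\<exists>C n0. \<forall>n\<ge>n0.
         expected_runtime n (decomp (N n) (a n) (F n)) (lam n)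
            (((1 - c) / (real n * real (a n 1))) / real n)
         \<le> ennreal (C * (real n ^ 2 * real (a n 1) * real (lam n) * ln (real n * real (a n 1))
                        + real n ^ (2 * r n + 2) * real (a n 1) ^ (r n + 1) * (1 / (1 - c)) ^ r n)))))"
proof (intro allI impI)
  fix K :: real assume K: "0 < K"
  show "\<exists>c'::real. c' > 0 \<and>
    (\<forall>(N :: nat \<Rightarrow> nat) (\<sigma> :: nat \<Rightarrow> nat \<Rightarrow> nat set) (F :: nat \<Rightarrow> nat \<Rightarrow> bool list \<Rightarrow> bool)
       (a :: nat \<Rightarrow> nat \<Rightarrow> nat) (r :: nat \<Rightarrow> nat) (lam :: nat \<Rightarrow> nat).
      (\<forall>n\<ge>1. decomp_instance n (N n) (\<sigma> n) (F n) (a n) (r n)) \<and>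
      (\<forall>n\<ge>1. real (lam n) \<ge> c' * real n ^ 2 * real (a n 1) ^ 2 * real (r n) * ln (real n * real (a n 1))) \<and>
      (\<exists>C. \<forall>n\<ge>1. real (lam n) \<le> C * (real n * real (a n 1)) powr K)
      \<longrightarrow>
      (\<exists>C n0. \<forall>n\<ge>n0.
         expected_runtime n (decomp (N n) (a n) (F n)) (lam n)
            (((1 - c) / (real n * real (a n 1))) / real n)
         \<le> ennreal (C * (real n ^ 2 * real (a n 1) * real (lam n) * ln (real n * real (a n 1))
                        + real n ^ (2 * r n + 2) * real (a n 1) ^ (r n + 1) * (1 / (1 - c)) ^ r n))))"
  proof (rule exI[of _ "192 / c ^ 3"], intro conjI allI impI, goal_cases)
    case 1
    show ?case using assms by simp
  next
    case (2 N \<sigma> F a r lam)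
    then have inst: "\<And>n. 1 \<le> n \<Longrightarrow> decomp_instance n (N n) (\<sigma> n) (F n) (a n) (r n)"
      and lam_lower: "\<And>n. 1 \<le> n \<Longrightarrow> 192 / c ^ 3 * real n ^ 2 * real (a n 1) ^ 2 * real (r n)
          * ln (real n * real (a n 1)) \<le> real (lam n)"
      by auto
    obtain C1 where C1: "\<And>n. 1 \<le> n \<Longrightarrow> real (lam n) \<le> C1 * (real n * real (a n 1)) powr K"
      using 2 by blast
    define C2 where "C2 = max C1 1"
    define C where "C = (ln C2 + K) / ln 2 + 2"
    define B where "B = 2 * exp 1 * (16 * C / c + 1 + 32 / c ^ 3)"
    define n0 where "n0 = nat \<lceil>max 3 (max (4 * B) (1 / (1 - c)))\<rceil>"
    show ?case
    proof (rule exI[of _ "2 * B"], rule exI[of _ n0], intro allI impI)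
      fix n assume "n0 \<le> n"
      then have "max 3 (max (4 * B) (1 / (1 - c))) \<le> real n" unfolding n0_def by linarith
      then have n: "3 \<le> n" "4 * B \<le> real n" "1 / (1 - c) \<le> real n" by auto
      interpret decomp_problem n "N n" "\<sigma> n" "F n" "a n" "r n"
        using inst n by unfold_locales auto
      define M where "M = real n * real (a n 1)"
      have a1: "1 \<le> real (a n 1)" using a_pos[of 1] N_pos by simp
      have M3: "3 \<le> M" using mult_mono[of 3 "real n" 1 "real (a n 1)"] a1 n by (simp add: M_def)
      have lnM: "1 \<le> ln M"
      proof -
        have "exp 1 \<le> M" using exp_le M3 by linarith
        then show ?thesis using M3 by (subst ln_ge_iff) auto
      qed
      have lower: "192 / c ^ 3 * M\<^sup>2 * real (r n) * ln M \<le> real (lam n)"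
        using lam_lower[of n] n by (simp add: M_def power_mult_distrib mult.assoc)
      have r1: "1 \<le> real (r n)" using r_pos by simp
      have lam_M: "32 * M \<le> c\<^sup>2 * real (lam n)"
      proof -
        have "192 / c ^ 3 * M\<^sup>2 * 1 * 1 \<le> 192 / c ^ 3 * M\<^sup>2 * real (r n) * ln M"
          using assms r1 lnM by (intro mult_mono) auto
        then have "c\<^sup>2 * (192 / c ^ 3 * M\<^sup>2) \<le> c\<^sup>2 * real (lam n)"
          using lower by (intro mult_left_mono) auto
        moreover have "c\<^sup>2 * (192 / c ^ 3 * M\<^sup>2) = 192 * M\<^sup>2 / c"
          using assms by (simp add: power2_eq_square power3_eq_cube)
        moreover have "192 * M\<^sup>2 / 1 \<le> 192 * M\<^sup>2 / c"
          using assms by (intro divide_left_mono) auto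
        moreover have "M * 1 \<le> M * M" using M3 by (intro mult_left_mono) auto
        ultimately show ?thesis using M3 unfolding power2_eq_square by linarith
      qed
      interpret E: decomp_ea n "N n" "\<sigma> n" "F n" "a n" "r n" c "lam n"
        using assms n lam_M by unfold_locales (auto simp: M_def)
      have EM: "E.M = M" by (simp only: E.M_def M_def)
      have lam0: "0 < real (lam n)" using E.population_pos .
      have C2: "1 \<le> C2" by (simp add: C2_def)
      have "real (lam n) \<le> C1 * M powr K" using C1[of n] n by (simp add: M_def)
      also have "\<dots> \<le> C2 * M powr K" by (intro mult_right_mono) (auto simp: C2_def)
      finally have "ln (real (lam n)) \<le> ln (C2 * M powr K)" using lam0 by (simp add: ln_mono)
      also have "\<dots> = ln C2 + K * ln M" using C2 M3 by (simp add: ln_mult ln_powr)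
      also have "\<dots> \<le> (ln C2 + K) * ln M"
        using mult_left_mono[OF lnM, of "ln C2"] C2 by (simp add: algebra_simps)
      finally have "log 2 (real (lam n)) \<le> (ln C2 + K) * ln M / ln 2"
        unfolding log_def by (intro divide_right_mono) auto
      then have logC: "log 2 (real (lam n)) + 2 \<le> C * ln M"
        using lnM by (simp add: C_def distrib_right)
      have "expected_runtime n f (lam n) E.p
          \<le> ennreal (2 * B * (real n * M * real (lam n) * ln M + real n * M / E.p ^ r n))"
        using lower logC B_def n(2,3) by (rule E.expected_runtime_le_explicit[unfolded EM])
      moreover have p_eq: "E.p = ((1 - c) / (real n * real (a n 1))) / real n"
        by (simp only: E.p_def EM M_def)
      moreover have "real n * M = real n ^ 2 * real (a n 1)" by (simp add: M_def power2_eq_square)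
      moreover have "real n * M / E.p ^ r n
          = real n ^ (2 * r n + 2) * real (a n 1) ^ (r n + 1) * (1 / (1 - c)) ^ r n"
      proof -
        have "1 / E.p = real n ^ 2 * real (a n 1) * (1 / (1 - c))"
          unfolding p_eq by (simp add: power2_eq_square)
        then have "1 / E.p ^ r n = real n ^ (2 * r n) * real (a n 1) ^ r n * (1 / (1 - c)) ^ r n"
          by (simp only: power_one_over[symmetric] power_mult_distrib power_mult)
        then have "real n * M * (1 / E.p ^ r n)
          = real n * M * (real n ^ (2 * r n) * real (a n 1) ^ r n * (1 / (1 - c)) ^ r n)"
          by simp
        then show ?thesis by (simp add: M_def power_add power2_eq_square ac_simps)
      qed
      ultimately show "expected_runtime n (decomp (N n) (a n) (F n)) (lam n)
            (((1 - c) / (real n * real (a n 1))) / real n)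
         \<le> ennreal (2 * B * (real n ^ 2 * real (a n 1) * real (lam n) * ln (real n * real (a n 1))
                        + real n ^ (2 * r n + 2) * real (a n 1) ^ (r n + 1) * (1 / (1 - c)) ^ r n))"
        by (simp only: M_def)
    qed
  qed
qed

end
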